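(* Consider the linear two-tier model and let $(A,\mathbf d,\Sigma_L,\boldsymbol\lambda)\in\mathfrak P$. Suppose that (C0) if any row of $A$ is deleted, the remaining rows contain two disjoint sets of rows such that the corresponding two submatrices of $A$ both have full column rank $L+G$; and that at least one of the following holds: (T1S) $|\mathcal H_4|\ge 3$ and $A[\mathcal B_{\mathcal H_4},1{:}L]$ contains an identity; (T2S) $|\mathcal H_4|\ge 2$, $|\mathcal H_5|\ge 1$, and $A[\mathcal B_{\mathcal H_4},1{:}L]$ contains an identity; (T3S) $A[:,1{:}L]$ contains an identity, and there is a partition of the testlets $\{1,\dots,G\}=\mathcal G_1\cup\mathcal G_2$ into disjoint sets such that (1) $\bar A_{\mathcal G_1}$ has full column rank, and (2) $A[\mathcal B_{\mathcal G_2},1{:}L]$ has full column rank. Then the model is identifiable at $(A,\mathbf d,\Sigma_L,\boldsymbol\lambda)$.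
   Context: Linear two-tier model. Fix $L\ge1$ main factors, $G\ge 1$ testlets, and items $\{1,\dots,J\}$ with a fixed known partition into nonempty testlets $\mathcal B_1,\dots,\mathcal B_G$; $g_j\in\{1,\dots,G\}$ is the testlet containing item $j$. Parameters: a real $J\times(L+G)$ loading matrix $A=(a_{jk})$ whose columns $1,\dots,L$ are main-factor loadings and whose column $L+g$ contains the loadings on the factor of testlet $g$, with $a_{j,L+g}=0$ whenever $g\ne g_j$; intercepts $\mathbf d\in\mathbb R^J$; an $L\times L$ symmetric positive definite matrix $\Sigma_L$ with unit diagonal; unique variances $\boldsymbol\lambda$ with $\lambda_j>0$. The observed vector is $$Y_j=d_j+\sum_{l=1}^L a_{jl}\eta_l+a_{j,L+g_j}\eta_{L+g_j}+\epsilon_j,$$ with $(\eta_1,\dots,\eta_{L+G})^T\sim N\left(\mathbf 0,\begin{pmatrix}\Sigma_L&\mathbf 0\\ \mathbf 0&I_{G\times G}\end{pmatrix}\right)$ and $\epsilon_j\sim N(0,\lambda_j)$ independent of each other and of the $\eta$'s. The parameter space $\mathfrak P$ is the set of all such $(A,\mathbf d,\Sigma_L,\boldsymbol\lambda)$ for which the first nonzero entry of every column of $A$ is positive (no requirement on a zero column). For a matrix $X$ let $\mathbf I(X)$ be the 0/1 matrix with entries $\mathbf 1\{X_{ij}\ne0\}$. The model is identifiable at $(A,\mathbf d,\Sigma_L,\boldsymbol\lambda)\in\mathfrak P$ if every $(A',\mathbf d',\Sigma_L',\boldsymbol\lambda')\in\mathfrak P$ that defines the same distribution of $(Y_1,\dots,Y_J)$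 and satisfies $\mathbf I(A')=\mathbf I(A)$ equals $(A,\mathbf d,\Sigma_L,\boldsymbol\lambda)$. Notation: $A[\mathcal B,\mathcal C]$ is the submatrix with rows in $\mathcal B$ and columns in $\mathcal C$. For $\mathcal G\subseteq\{1,\dots,G\}$: $\mathcal B_{\mathcal G}=\bigcup_{g\in\mathcal G}\mathcal B_g$, $L+\mathcal G=\{L+g: g\in\mathcal G\}$, $\bar A_{\mathcal G}=(A[\mathcal B_{\mathcal G},1{:}L],A[\mathcal B_{\mathcal G},L+\mathcal G])$, and $\bar A_g=\bar A_{\{g\}}$. - $\mathcal H_4=\{g: A[\mathcal B_g,1{:}L]\text{ is of full column rank}\}$. - $\mathcal H_5=\{g:\bar A_g\text{ is of full column rank}\}$. - For a set $\mathcal B$ of items, "$A[\mathcal B,1{:}L]$ contains an identity" means: for each $l\in\{1,\dots,L\}$ there is an item in $\mathcal B$ whose loading on main factor $l$ is nonzero and whose loadings on all other main factors are zero (it may load on its testlet factor). *)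

theory Defs
  imports "HOL-Probability.Probability"
begin

text \<open>
  Items, main factors and testlets are indexed by the finite types \<open>'j\<close>, \<open>'l\<close>, \<open>'g\<close>, so
  \<open>J = CARD('j)\<close>, \<open>L = CARD('l)\<close>, \<open>G = CARD('g)\<close>, all automatically at least 1.  The columns of
  a loading matrix are indexed by \<open>'l + 'g\<close>: \<open>Inl l\<close> is main factor \<open>l\<close>, \<open>Inr g\<close> is the factor
  of testlet \<open>g\<close>.  The linear order on \<open>'j\<close> is the order of the rows; it matters only for the
  sign convention on columns.  The partition into testlets is a map \<open>tst :: 'j \<Rightarrow> 'g\<close> taking an
  item to its testlet; the testlets are nonempty iff it is surjective.
\<close>

definition positive_definite :: "real^'n^'n \<Rightarrow> bool" where
  "positive_definite S \<longleftrightarrow> transpose S = S \<and> (\<forall>x. x \<noteq> 0 \<longrightarrow> x \<bullet> (S *v x) > 0)"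

text \<open>The normal law with mean \<open>m\<close> and covariance matrix \<open>S\<close>, for positive definite \<open>S\<close>.\<close>

definition multivariate_normal :: "real^'n \<Rightarrow> real^'n^'n \<Rightarrow> (real^'n) measure" where
  "multivariate_normal m S = density lborel (\<lambda>x. ennreal
     (exp (- ((x - m) \<bullet> (matrix_inv S *v (x - m))) / 2) / sqrt ((2 * pi) ^ CARD('n) * det S)))"

definition factor_cov :: "real^'l^'l \<Rightarrow> real^('l::finite + 'g::finite)^('l + 'g)" where
  "factor_cov S = (\<chi> p q. case (p, q) of
      (Inl k, Inl l) \<Rightarrow> S $ k $ l
    | (Inr g, Inr h) \<Rightarrow> of_bool (g = h)
    | _ \<Rightarrow> 0)"

text \<open>
  The law of \<open>(Y\<^sub>1, \<dots>, Y\<^sub>J)\<close>.  The second argument of \<open>normal_density\<close> is the standard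
  deviation, whereas \<open>lam\<close> contains variances.
\<close>

definition two_tier_law ::
  "('j \<Rightarrow> 'g) \<Rightarrow> real^('l::finite + 'g::finite)^'j \<Rightarrow> real^'j \<Rightarrow> real^'l^'l \<Rightarrow> real^'j
    \<Rightarrow> (real^'j::finite) measure" where
  "two_tier_law tst A d S lam =
     distr
       (multivariate_normal 0 (factor_cov S :: real^('l + 'g)^('l + 'g)) \<Otimes>\<^sub>M
        (\<Pi>\<^sub>M j\<in>UNIV. density lborel (\<lambda>x. ennreal (normal_density 0 (sqrt (lam $ j)) x))))
       borel
       (\<lambda>(eta, eps). \<chi> j. d $ j + (\<Sum>l\<in>UNIV. A $ j $ Inl l * eta $ Inl l)
                           + A $ j $ Inr (tst j) * eta $ Inr (tst j) + eps j)"

definition two_tier_params ::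
  "('j::{finite,linorder} \<Rightarrow> 'g::finite)
    \<Rightarrow> ((real^('l::finite + 'g)^'j::{finite,linorder}) \<times> (real^'j::{finite,linorder})
        \<times> (real^'l^'l) \<times> (real^'j::{finite,linorder})) set" where
  "two_tier_params tst = {(A, d, S, lam).
      (\<forall>j g. g \<noteq> tst j \<longrightarrow> A $ j $ Inr g = 0) \<and>
      positive_definite S \<and> (\<forall>l. S $ l $ l = 1) \<and>
      (\<forall>j. lam $ j > 0) \<and>
      (\<forall>k j. A $ j $ k \<noteq> 0 \<and> (\<forall>i<j. A $ i $ k = 0) \<longrightarrow> A $ j $ k > 0)}"

definition nonzero_pattern :: "real^'n^'m \<Rightarrow> real^'n^'m" where
  "nonzero_pattern X = (\<chi> i j. of_bool (X $ i $ j \<noteq> 0))"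

definition identifiable_at ::
  "('j::{finite,linorder} \<Rightarrow> 'g::finite) \<Rightarrow> real^('l::finite + 'g)^'j::{finite,linorder}
    \<Rightarrow> real^'j::{finite,linorder} \<Rightarrow> real^'l^'l \<Rightarrow> real^'j::{finite,linorder} \<Rightarrow> bool" where
  "identifiable_at tst A d S lam \<longleftrightarrow>
     (\<forall>A' d' S' lam'.
        (A', d', S', lam') \<in> two_tier_params tst \<and>
        two_tier_law tst A' d' S' lam' = two_tier_law tst A d S lam \<and>
        nonzero_pattern A' = nonzero_pattern A
        \<longrightarrow> (A', d', S', lam') = (A, d, S, lam))"

text \<open>
  The submatrix \<open>X[R, C]\<close> is represented with the shape of \<open>X\<close>, padded by zeros outside
  \<open>R \<times> C\<close>; this does not change its rank.
\<close>

definition submat :: "real^'n^'m \<Rightarrow> 'm set \<Rightarrow> 'n set \<Rightarrow> real^'n^'m" where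
  "submat X R C = (\<chi> i j. if i \<in> R \<and> j \<in> C then X $ i $ j else 0)"

definition full_column_rank :: "real^'n^'m \<Rightarrow> 'm set \<Rightarrow> 'n set \<Rightarrow> bool" where
  "full_column_rank X R C \<longleftrightarrow> rank (submat X R C) = card C"

abbreviation main_factors :: "('l + 'g) set" where
  "main_factors \<equiv> range Inl"

text \<open>\<open>items tst gs\<close> is the set of items belonging to the testlets in \<open>gs\<close>.\<close>

definition items :: "('j \<Rightarrow> 'g) \<Rightarrow> 'g set \<Rightarrow> 'j set" where
  "items tst gs = {j. tst j \<in> gs}"

definition H4 :: "('j \<Rightarrow> 'g) \<Rightarrow> real^('l::finite + 'g::finite)^'j \<Rightarrow> 'g set" where
  "H4 tst A = {g. full_column_rank A (items tst {g}) main_factors}"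

definition H5 :: "('j \<Rightarrow> 'g) \<Rightarrow> real^('l::finite + 'g::finite)^'j \<Rightarrow> 'g set" where
  "H5 tst A = {g. full_column_rank A (items tst {g}) (main_factors \<union> {Inr g})}"

definition contains_identity :: "real^('l::finite + 'g::finite)^'j \<Rightarrow> 'j set \<Rightarrow> bool" where
  "contains_identity A B \<longleftrightarrow>
     (\<forall>l. \<exists>j\<in>B. A $ j $ Inl l \<noteq> 0 \<and> (\<forall>l'. l' \<noteq> l \<longrightarrow> A $ j $ Inl l' = 0))"

definition C0 :: "real^('l::finite + 'g::finite)^'j \<Rightarrow> bool" where
  "C0 A \<longleftrightarrow>
     (\<forall>j. \<exists>R1 R2. R1 \<subseteq> UNIV - {j} \<and> R2 \<subseteq> UNIV - {j} \<and> R1 \<inter> R2 = {} \<and>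
        full_column_rank A R1 UNIV \<and> full_column_rank A R2 UNIV)"

definition T1S :: "('j \<Rightarrow> 'g) \<Rightarrow> real^('l::finite + 'g::finite)^'j \<Rightarrow> bool" where
  "T1S tst A \<longleftrightarrow> card (H4 tst A) \<ge> 3 \<and> contains_identity A (items tst (H4 tst A))"

definition T2S :: "('j \<Rightarrow> 'g) \<Rightarrow> real^('l::finite + 'g::finite)^'j \<Rightarrow> bool" where
  "T2S tst A \<longleftrightarrow> card (H4 tst A) \<ge> 2 \<and> card (H5 tst A) \<ge> 1 \<and>
     contains_identity A (items tst (H4 tst A))"

definition T3S :: "('j \<Rightarrow> 'g) \<Rightarrow> real^('l::finite + 'g::finite)^'j \<Rightarrow> bool" where
  "T3S tst A \<longleftrightarrow> contains_identity A UNIV \<and>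
     (\<exists>G1 G2. G1 \<union> G2 = UNIV \<and> G1 \<inter> G2 = {} \<and>
        full_column_rank A (items tst G1) (main_factors \<union> Inr ` G1) \<and>
        full_column_rank A (items tst G2) main_factors)"

end

theory Submission
  imports Defs
begin

text \<open>
  The law of \<open>Y\<close> is normal with mean \<open>d\<close> and covariance \<open>A \<Phi> A\<^sup>T + diag lam\<close>, where \<open>\<Phi>\<close> is
  \<open>factor_cov S\<close>.  Its moment generating function recovers \<open>d\<close> and this matrix
  (\<open>two_tier_law_moments\<close>), and what remains is linear algebra on the rows of \<open>A\<close>: a competing
  parameter \<open>A'\<close>, \<open>S'\<close>, \<open>lam'\<close> has the same covariance matrix, and has to be shown equal.

  One observation is used three times (\<open>cross_covariance_transfer\<close>).  Let \<open>f i\<close>, \<open>f' i\<close> be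
  vectors attached to the items, with covariances \<open>f i \<bullet> (S *v f j)\<close> and
  \<open>f' i \<bullet> (S' *v f' j)\<close>.  If these agree on \<open>P \<times> Q\<close>, and the \<open>f i\<close> span the whole space both
  for \<open>i \<in> P\<close> and for \<open>i \<in> Q\<close>, then linear bijections \<open>T\<close> and \<open>U\<close> carry \<open>f\<close> to \<open>f'\<close> on \<open>P\<close> and on \<open>Q\<close>,
  respectively, and \<open>x \<bullet> (S *v y) = T x \<bullet> (S' *v U y)\<close>.

  Unique variances.  Take the full rows of \<open>A\<close> as vectors and the two disjoint sets of rows that
  (C0) supplies after deletion of row \<open>j\<close>.  Row \<open>j\<close> has correct covariances with both sets, hence is
  moved by \<open>T\<close> and by \<open>U\<close> alike, so its communality is determined as well
  (\<open>communality_unique\<close>).  This gives \<open>lam = lam'\<close>, and then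
  \<open>A \<Phi> A\<^sup>T = A' \<Phi>' A'\<^sup>T\<close>.

  Main factors.  Take now as \<open>f i\<close> the main loadings of item \<open>i\<close>.  Items of different testlets are
  correlated through the main factors only.  It has to be shown that \<open>T = U\<close>, for then \<open>f' = T f\<close>
  with \<open>T\<close> an isometry from \<open>S\<close> to \<open>S'\<close>.  Under (T1S) a third testlet compares \<open>T\<close> with \<open>U\<close>
  (\<open>isometry_from_three_testlets\<close>).  Under (T3S) the rank condition on the first group of testlets
  separates the testlet part of the covariance from the main part, which makes \<open>T\<close> itself an isometry
  (\<open>isometry_from_testlet_bipartition\<close>).  (T2S) is a special case of (T3S): the first group is a
  single testlet of \<open>H5\<close>, and the second contains another one of \<open>H4\<close>.

  Signs.  The identity block and the common zero pattern make \<open>T\<close> diagonal, and the unit diagonals of \<open>S\<close>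
  and \<open>S'\<close> make its entries \<open>1\<close> or \<open>-1\<close> (\<open>isometry_diagonal\<close>).  The sign convention excludes \<open>-1\<close>.
  What is left of the covariance within a testlet is the product of two testlet loadings, and the
  sign convention settles these in the same way (\<open>sign_convention_unique\<close>).
\<close>

section \<open>Positive definite matrices\<close>

lemma pd_sym: "positive_definite S \<Longrightarrow> x \<bullet> (S *v y) = y \<bullet> (S *v x)"
  by (metis dot_lmul_matrix inner_commute positive_definite_def transpose_matrix_vector)

lemma pd_zero: "positive_definite S \<Longrightarrow> x \<bullet> (S *v x) = 0 \<Longrightarrow> x = 0"
  by (force simp: positive_definite_def)

lemma pd_mat_1: "positive_definite (mat 1)"
  by (auto simp: positive_definite_def)

text \<open>
  Positive definite matrices form a convex set; \<open>pd_det_pos\<close> uses the segment from the identity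
  to \<open>S\<close>.
\<close>

lemma pd_convex_comb:
  assumes "positive_definite S" "positive_definite T" "0 \<le> t" "t \<le> 1"
  shows "positive_definite ((1 - t) *\<^sub>R S + t *\<^sub>R T)"
proof -
  have "x \<bullet> (((1 - t) *\<^sub>R S + t *\<^sub>R T) *v x) > 0" if "x \<noteq> 0" for x
  proof -
    have "x \<bullet> (((1 - t) *\<^sub>R S + t *\<^sub>R T) *v x) = (1 - t) * (x \<bullet> (S *v x)) + t * (x \<bullet> (T *v x))"
      by (simp add: matrix_vector_mult_add_rdistrib inner_right_distrib flip: scaleR_matrix_vector_assoc)
    moreover have "x \<bullet> (S *v x) > 0" "x \<bullet> (T *v x) > 0"
      using assms(1,2) that by (auto simp: positive_definite_def)
    ultimately show ?thesis
      using assms(3,4) by (cases "t = 1") (auto intro: add_pos_nonneg)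
  qed
  then show ?thesis
    using assms(1,2) by (simp add: positive_definite_def transpose_def vec_eq_iff)
qed

lemma pd_invertible: "invertible S" if "positive_definite S" for S :: "real^'n^'n"
proof -
  have "x = 0" if "S *v x = 0" for x
    using that pd_zero[OF \<open>positive_definite S\<close>, of x] by simp
  then show ?thesis
    by (simp add: invertible_left_inverse matrix_left_invertible_ker)
qed

text \<open>
  On the segment from the identity to \<open>S\<close> the determinant is continuous, starts at \<open>1\<close> and never
  vanishes, because all matrices on it are invertible; so it cannot become negative.
\<close>

lemma pd_det_pos:
  fixes S :: "real^'n^'n"
  assumes "positive_definite S"
  shows "det S > 0"
proof (rule ccontr)
  assume "\<not> det S > 0"
  let ?p = "\<lambda>t. (1 - t) *\<^sub>R mat 1 + t *\<^sub>R S"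
  have "continuous_on {0..1} (\<lambda>t. det (?p t))"
    unfolding det_def by (intro continuous_intros continuous_on_component) 
  then obtain t where "0 \<le> t" "t \<le> 1" "det (?p t) = 0"
    using IVT2'[of "\<lambda>t. det (?p t)" 1 0 0] \<open>\<not> det S > 0\<close> by auto
  moreover from this have "invertible (?p t)"
    by (intro pd_invertible pd_convex_comb pd_mat_1 assms)
  ultimately show False by (simp add: invertible_det_nz)
qed

lemma pd_inverse:
  assumes "positive_definite S"
  shows "S *v (matrix_inv S *v x) = x" "matrix_inv S *v (S *v x) = x"
    "positive_definite (matrix_inv S)"
proof -
  have "S ** matrix_inv S = mat 1" "matrix_inv S ** S = mat 1"
    using someI_ex[OF pd_invertible[OF assms, unfolded invertible_def]]
    by (auto simp: matrix_inv_def)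
  then show 1: "S *v (matrix_inv S *v x) = x" and 2: "matrix_inv S *v (S *v x) = x" for x
    by (simp_all add: matrix_vector_mul_assoc)
  have "transpose (matrix_inv S) = matrix_inv S"
  proof -
    have "transpose (matrix_inv S) ** S = mat 1"
      using \<open>S ** matrix_inv S = mat 1\<close> assms
      by (metis matrix_transpose_mul positive_definite_def transpose_mat)
    then show ?thesis
      by (metis \<open>S ** matrix_inv S = mat 1\<close> matrix_mul_assoc matrix_mul_lid matrix_mul_rid)
  qed
  moreover have "x \<bullet> (matrix_inv S *v x) > 0" if "x \<noteq> 0" for x
  proof -
    have "matrix_inv S *v x \<noteq> 0" using that 1[of x] by auto
    then have "(matrix_inv S *v x) \<bullet> (S *v (matrix_inv S *v x)) > 0"
      using assms unfolding positive_definite_def by blast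
    then show ?thesis by (simp add: 1 inner_commute)
  qed
  ultimately show "positive_definite (matrix_inv S)"
    by (auto simp: positive_definite_def)
qed

text \<open>
  The quadratic form attains a positive minimum on the unit sphere; scaling does the rest.
\<close>

lemma pd_coercive:
  fixes S :: "real^'n^'n"
  assumes "positive_definite S"
  obtains e where "e > 0" "\<And>x. e * (x \<bullet> x) \<le> x \<bullet> (S *v x)"
proof -
  have "continuous_on (sphere 0 1) (\<lambda>x. x \<bullet> (S *v x))"
    by (intro continuous_intros matrix_vector_mult_linear_continuous_on)
  moreover have "sphere (0 :: real^'n) 1 \<noteq> {}" by simp
  ultimately obtain z where z: "z \<in> sphere 0 1"
    "\<And>y. y \<in> sphere 0 1 \<Longrightarrow> z \<bullet> (S *v z) \<le> y \<bullet> (S *v y)"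
    using continuous_attains_inf[of "sphere 0 1" "\<lambda>x. x \<bullet> (S *v x)"] by auto
  show ?thesis
  proof (rule that)
    show "z \<bullet> (S *v z) > 0"
      using assms z(1) unfolding positive_definite_def by (metis norm_zero mem_sphere_0 zero_neq_one)
    show "z \<bullet> (S *v z) * (x \<bullet> x) \<le> x \<bullet> (S *v x)" for x
    proof (cases "x = 0")
      case False
      define y where "y = (1 / norm x) *\<^sub>R x"
      have "y \<in> sphere 0 1" using False by (simp add: y_def)
      then have "z \<bullet> (S *v z) \<le> y \<bullet> (S *v y)" by (rule z(2))
      also have "y \<bullet> (S *v y) = (x \<bullet> (S *v x)) / (x \<bullet> x)"
        by (simp add: y_def matrix_vector_mult_scaleR power2_eq_square flip: power2_norm_eq_inner)
      finally show ?thesis using False by (simp add: pos_le_divide_eq)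
    qed simp
  qed
qed

lemma pd_factor_cov:
  assumes "positive_definite (S :: real^'l^'l)"
  shows "positive_definite (factor_cov S :: real^('l::finite + 'g::finite)^('l + 'g))"
    and "x \<bullet> ((factor_cov S :: real^('l + 'g)^('l + 'g)) *v y) =
       (\<chi> l. x $ Inl l) \<bullet> (S *v (\<chi> l. y $ Inl l)) + (\<Sum>g\<in>UNIV. x $ Inr g * y $ Inr g)"
proof -
  have sum_split: "(\<Sum>p\<in>UNIV. h p) = (\<Sum>l\<in>UNIV. h (Inl l)) + (\<Sum>g\<in>UNIV. h (Inr g))"
    for h :: "'l + 'g \<Rightarrow> real"
    by (simp add: UNIV_Plus_UNIV[symmetric] sum.Plus del: UNIV_Plus_UNIV)
  show form: "x \<bullet> ((factor_cov S :: real^('l + 'g)^('l + 'g)) *v y) =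
       (\<chi> l. x $ Inl l) \<bullet> (S *v (\<chi> l. y $ Inl l)) + (\<Sum>g\<in>UNIV. x $ Inr g * y $ Inr g)" for x y
    by (simp add: inner_vec_def matrix_vector_mult_def sum_split factor_cov_def)
  have "x \<bullet> ((factor_cov S :: real^('l + 'g)^('l + 'g)) *v x) > 0" if "x \<noteq> 0" for x
  proof -
    let ?u = "\<chi> l. x $ Inl l"
    have nn: "?u \<bullet> (S *v ?u) \<ge> 0"
      using assms unfolding positive_definite_def by (cases "?u = 0") (auto intro: less_imp_le)
    have nn2: "(\<Sum>g\<in>UNIV. x $ Inr g * x $ Inr g) \<ge> 0" by (intro sum_nonneg) simp
    show ?thesis
    proof (cases "?u = 0")
      case True
      have "\<exists>g. x $ Inr g \<noteq> 0"
      proof (rule ccontr)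
        assume "\<not> ?thesis"
        then have "x $ p = 0" for p using True by (cases p) (auto simp: vec_eq_iff)
        then show False using that by (simp add: vec_eq_iff)
      qed
      then obtain g where "x $ Inr g \<noteq> 0" by blast
      then have "(\<Sum>g\<in>UNIV. x $ Inr g * x $ Inr g) > 0"
        by (intro sum_pos2[of _ g]) (auto simp: zero_less_mult_iff linorder_neq_iff)
      then show ?thesis using nn by (simp add: form)
    next
      case False
      then have "?u \<bullet> (S *v ?u) > 0" using assms unfolding positive_definite_def by blast
      then show ?thesis using nn2 by (simp add: form)
    qed
  qed
  moreover have "transpose S = S" using assms by (simp add: positive_definite_def)
  then have "transpose (factor_cov S) = (factor_cov S :: real^('l + 'g)^('l + 'g))"
    by (auto simp: transpose_def factor_cov_def vec_eq_iff split: sum.splits)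
  ultimately show "positive_definite (factor_cov S :: real^('l + 'g)^('l + 'g))"
    by (auto simp: positive_definite_def)
qed

section \<open>Moment generating functions\<close>

lemma borel_quadratic [measurable]:
  fixes S :: "real^'n^'n"
  shows "(\<lambda>x. x \<bullet> (S *v x)) \<in> borel_measurable borel"
  by (intro borel_measurable_continuous_onI continuous_intros matrix_vector_mult_linear_continuous_on)

text \<open>
  The integrand is a product of functions of one coordinate each, and each factor is a multiple of a
  normal density.
\<close>

lemma nn_integral_exp_square_finite:
  fixes c :: real
  assumes "c > 0"
  shows "(\<integral>\<^sup>+x. ennreal (exp (- c * (x \<bullet> x))) \<partial>(lborel :: (real^'n) measure)) < \<infinity>"
proof -
  have one: "(\<integral>\<^sup>+x. ennreal (exp (- c * (x * x))) \<partial>lborel) < \<infinity>"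
  proof -
    \<comment> \<open>The standard deviation for which \<open>exp (- c * x\<^sup>2)\<close> is proportional to the density.\<close>
    define s where "s = 1 / sqrt (2 * c)"
    have s: "s > 0" "s\<^sup>2 = 1 / (2 * c)"
      using assms by (simp_all add: s_def power_divide)
    interpret prob_space "density lborel (normal_density 0 s)"
      by (rule prob_space_normal_density[OF s(1)])
    have "exp (- c * (x * x)) = sqrt (2 * pi * s\<^sup>2) * normal_density 0 s x" for x
      using assms by (simp add: normal_density_def s(2)) (simp add: power2_eq_square field_simps)
    then have "(\<integral>\<^sup>+x. ennreal (exp (- c * (x * x))) \<partial>lborel)
        = (\<integral>\<^sup>+x. ennreal (sqrt (2 * pi * s\<^sup>2)) * ennreal (normal_density 0 s x) \<partial>lborel)"
      by (simp add: ennreal_mult)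
    also have "\<dots> = ennreal (sqrt (2 * pi * s\<^sup>2)) * emeasure (density lborel (normal_density 0 s)) UNIV"
      by (simp add: nn_integral_cmult emeasure_density)
    also have "\<dots> < \<infinity>"
      using emeasure_space_1 by (simp add: ennreal_mult_less_top)
    finally show ?thesis .
  qed
  have "(\<integral>\<^sup>+x. ennreal (exp (- c * (x \<bullet> x))) \<partial>(lborel :: (real^'n) measure))
      = (\<integral>\<^sup>+x. (\<Prod>b\<in>Basis. ennreal (exp (- c * ((x \<bullet> b) * (x \<bullet> b))))) \<partial>(lborel :: (real^'n) measure))"
  proof (rule nn_integral_cong)
    fix x :: "real^'n"
    have "- c * (x \<bullet> x) = (\<Sum>b\<in>Basis. - c * ((x \<bullet> b) * (x \<bullet> b)))"
      by (subst euclidean_inner) (simp add: sum_distrib_left)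
    then show "ennreal (exp (- c * (x \<bullet> x))) = (\<Prod>b\<in>Basis. ennreal (exp (- c * ((x \<bullet> b) * (x \<bullet> b)))))"
      by (simp only: exp_sum[OF finite_Basis] prod_ennreal exp_ge_zero)
  qed
  also have "\<dots> = (\<Prod>b\<in>(Basis :: (real^'n) set). \<integral>\<^sup>+x. ennreal (exp (- c * (x * x))) \<partial>lborel)"
    by (rule nn_integral_lborel_prod) auto
  also have "\<dots> < \<infinity>"
    using one by (simp add: power_less_top_ennreal)
  finally show ?thesis .
qed

lemma sets_multivariate_normal [measurable_cong, simp]: "sets (multivariate_normal m S) = sets borel"
  by (simp add: multivariate_normal_def)

lemma space_multivariate_normal [simp]: "space (multivariate_normal m S) = UNIV"
  by (simp add: multivariate_normal_def)

text \<open>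
  The total mass of the centred normal law, kept as a symbol: it multiplies the moment generating
  functions of two laws that are compared, where it cancels because it is finite and nonzero.
\<close>

definition gauss_mass :: "real^'n^'n \<Rightarrow> ennreal" where
  "gauss_mass S = emeasure (multivariate_normal 0 S) UNIV"

text \<open>
  Finiteness comes from coercivity of \<open>matrix_inv S\<close>, which bounds the density by a spherical one;
  the mass is nonzero because \<open>det S > 0\<close> makes the density positive everywhere.
\<close>

lemma gauss_mass_finite_nonzero:
  fixes S :: "real^'n^'n"
  assumes "positive_definite S"
  shows "gauss_mass S < \<infinity>" "gauss_mass S \<noteq> 0"
proof -
  define N where "N = sqrt ((2 * pi) ^ CARD('n) * det S)"
  have N: "N > 0" using pd_det_pos[OF assms] by (simp add: N_def)
  have mass: "gauss_mass S = (\<integral>\<^sup>+x. ennreal (exp (- (x \<bullet> (matrix_inv S *v x)) / 2) / N) \<partial>lborel)"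
    using borel_quadratic[of "matrix_inv S"]
    by (simp add: gauss_mass_def multivariate_normal_def N_def emeasure_density)
  obtain e where e: "e > 0" "\<And>x. e * (x \<bullet> x) \<le> x \<bullet> (matrix_inv S *v x)"
    using pd_coercive[OF pd_inverse(3)[OF assms]] by blast
  have "gauss_mass S \<le> (\<integral>\<^sup>+x. ennreal (1 / N) * ennreal (exp (- (e / 2) * (x \<bullet> x))) \<partial>(lborel :: (real^'n) measure))"
    unfolding mass
  proof (rule nn_integral_mono)
    fix x :: "real^'n"
    have "exp (- (x \<bullet> (matrix_inv S *v x)) / 2) / N \<le> 1 / N * exp (- (e / 2) * (x \<bullet> x))"
      using e(2)[of x] N by (simp add: divide_right_mono)
    then show "ennreal (exp (- (x \<bullet> (matrix_inv S *v x)) / 2) / N)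
        \<le> ennreal (1 / N) * ennreal (exp (- (e / 2) * (x \<bullet> x)))"
      using N by (simp add: ennreal_leI flip: ennreal_mult)
  qed
  also have "\<dots> = ennreal (1 / N) * (\<integral>\<^sup>+x. ennreal (exp (- (e / 2) * (x \<bullet> x))) \<partial>(lborel :: (real^'n) measure))"
    by (rule nn_integral_cmult) simp
  also have "\<dots> < \<infinity>"
    using nn_integral_exp_square_finite[of "e / 2", where 'n = 'n] e(1)
    by (simp add: ennreal_mult_less_top)
  finally show "gauss_mass S < \<infinity>" .
  show "gauss_mass S \<noteq> 0"
  proof
    assume "gauss_mass S = 0"
    then have "AE x :: real^'n in lborel. ennreal (exp (- (x \<bullet> (matrix_inv S *v x)) / 2) / N) = 0"
      unfolding mass using borel_quadratic[of "matrix_inv S"]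
      by (subst (asm) nn_integral_0_iff_AE) auto
    then have "AE x :: real^'n in lborel. False"
      using N by (auto simp: ennreal_eq_0_iff field_simps not_le)
    then show False
      using ae_filter_eq_bot_iff[of "lborel :: (real^'n) measure"]
      by (simp add: trivial_limit_def)
  qed
qed

lemma nn_integral_lborel_translate:
  fixes c :: "'a::euclidean_space"
  assumes [measurable]: "f \<in> borel_measurable borel"
  shows "(\<integral>\<^sup>+x. f (x - c) \<partial>lborel) = (\<integral>\<^sup>+x. f x \<partial>lborel)"
  by (subst (2) lborel_distr_plus[of "- c", symmetric]) (simp add: nn_integral_distr)

text \<open>
  Completing the square turns the integrand into a translate of the density, and Lebesgue measure is
  invariant under translation.
\<close>

lemma mgf_multivariate_normal:
  fixes S :: "real^'n^'n"
  assumes "positive_definite S"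
  shows "(\<integral>\<^sup>+x. ennreal (exp (s \<bullet> x)) \<partial>multivariate_normal 0 S)
    = ennreal (exp (s \<bullet> (S *v s) / 2)) * gauss_mass S"
proof -
  define N where "N = sqrt ((2 * pi) ^ CARD('n) * det S)"
  let ?Q = "matrix_inv S"
  let ?p = "\<lambda>x. ennreal (exp (- (x \<bullet> (?Q *v x)) / 2) / N)"
  have N: "N > 0" using pd_det_pos[OF assms] by (simp add: N_def)
  have mn: "multivariate_normal 0 S = density lborel ?p"
    by (simp add: multivariate_normal_def N_def)
  have sq: "s \<bullet> x - (x \<bullet> (?Q *v x)) / 2
      = s \<bullet> (S *v s) / 2 - ((x - S *v s) \<bullet> (?Q *v (x - S *v s))) / 2" for x
  proof -
    have "(S *v s) \<bullet> (?Q *v x) = x \<bullet> s" "(S *v s) \<bullet> (?Q *v (S *v s)) = s \<bullet> (S *v s)"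
      using pd_sym[OF pd_inverse(3)[OF assms], of "S *v s" x]
      by (simp_all add: pd_inverse(2)[OF assms] inner_commute)
    then show ?thesis
      by (simp add: matrix_vector_mult_diff_distrib inner_diff_left inner_diff_right
          pd_inverse(2)[OF assms] inner_commute field_simps)
  qed
  have "(\<integral>\<^sup>+x. ennreal (exp (s \<bullet> x)) \<partial>multivariate_normal 0 S)
      = (\<integral>\<^sup>+x. ?p x * ennreal (exp (s \<bullet> x)) \<partial>lborel)"
    unfolding mn by (rule nn_integral_density) simp_all
  also have "\<dots> = (\<integral>\<^sup>+x. ennreal (exp (s \<bullet> (S *v s) / 2)) * ?p (x - S *v s) \<partial>lborel)"
  proof (rule nn_integral_cong)
    fix x
    have "- (x \<bullet> (?Q *v x)) / 2 + s \<bullet> x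
        = s \<bullet> (S *v s) / 2 + - ((x - S *v s) \<bullet> (?Q *v (x - S *v s))) / 2"
      using sq[of x] by linarith
    then have "exp (- (x \<bullet> (?Q *v x)) / 2) * exp (s \<bullet> x)
        = exp (s \<bullet> (S *v s) / 2) * exp (- ((x - S *v s) \<bullet> (?Q *v (x - S *v s))) / 2)"
      by (simp only: mult_exp_exp)
    then show "?p x * ennreal (exp (s \<bullet> x)) = ennreal (exp (s \<bullet> (S *v s) / 2)) * ?p (x - S *v s)"
      using N by (simp add: field_simps flip: ennreal_mult)
  qed
  also have "\<dots> = ennreal (exp (s \<bullet> (S *v s) / 2)) * (\<integral>\<^sup>+x. ?p (x - S *v s) \<partial>lborel)"
    by (rule nn_integral_cmult) simp
  also have "(\<integral>\<^sup>+x. ?p (x - S *v s) \<partial>lborel) = (\<integral>\<^sup>+x. ?p x \<partial>lborel)"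
    by (rule nn_integral_lborel_translate) simp
  also have "\<dots> = gauss_mass S"
    by (simp add: gauss_mass_def mn emeasure_density)
  finally show ?thesis .
qed

lemma mgf_normal:
  assumes "v > 0"
  shows "(\<integral>\<^sup>+x. ennreal (exp (t * x)) \<partial>density lborel (\<lambda>x. ennreal (normal_density 0 (sqrt v) x)))
    = ennreal (exp (v * t\<^sup>2 / 2))"
proof -
  interpret prob_space "density lborel (normal_density (v * t) (sqrt v))"
    using assms by (intro prob_space_normal_density) simp
  have "(\<integral>\<^sup>+x. ennreal (exp (t * x)) \<partial>density lborel (\<lambda>x. ennreal (normal_density 0 (sqrt v) x)))
      = (\<integral>\<^sup>+x. ennreal (normal_density 0 (sqrt v) x) * ennreal (exp (t * x)) \<partial>lborel)"
    by (rule nn_integral_density) simp_all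
  also have "\<dots> = (\<integral>\<^sup>+x. ennreal (exp (v * t\<^sup>2 / 2)) * ennreal (normal_density (v * t) (sqrt v) x) \<partial>lborel)"
  proof (rule nn_integral_cong)
    fix x
    have "- (x\<^sup>2 / (2 * v)) + t * x = v * t\<^sup>2 / 2 + - ((x - v * t)\<^sup>2 / (2 * v))"
      using assms by (simp add: field_simps power2_eq_square)
    then have "exp (- (x\<^sup>2 / (2 * v))) * exp (t * x) = exp (v * t\<^sup>2 / 2) * exp (- ((x - v * t)\<^sup>2 / (2 * v)))"
      by (simp only: mult_exp_exp)
    then have "normal_density 0 (sqrt v) x * exp (t * x)
        = exp (v * t\<^sup>2 / 2) * normal_density (v * t) (sqrt v) x"
      using assms by (simp add: normal_density_def field_simps)
    then show "ennreal (normal_density 0 (sqrt v) x) * ennreal (exp (t * x))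
        = ennreal (exp (v * t\<^sup>2 / 2)) * ennreal (normal_density (v * t) (sqrt v) x)"
      by (simp flip: ennreal_mult)
  qed
  also have "\<dots> = ennreal (exp (v * t\<^sup>2 / 2)) * emeasure (density lborel (normal_density (v * t) (sqrt v))) UNIV"
    by (simp add: nn_integral_cmult emeasure_density)
  finally show ?thesis using emeasure_space_1 by simp
qed

section \<open>Moments of the two-tier law\<close>

text \<open>
  A linear functional of \<open>Y\<close> splits into a constant, a linear functional of the factors and one of
  the errors.  The weights \<open>t\<close> act on the factors through \<open>A\<^sup>T t\<close>, written here as a combination of the
  rows of \<open>A\<close>.
\<close>

lemma two_tier_combination:
  fixes A :: "real^('l::finite + 'g::finite)^'j"
  assumes "\<forall>j g. g \<noteq> tst j \<longrightarrow> A $ j $ Inr g = 0"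
  shows "t \<bullet> (\<chi> j. d $ j + (\<Sum>l\<in>UNIV. A $ j $ Inl l * eta $ Inl l)
                   + A $ j $ Inr (tst j) * eta $ Inr (tst j) + eps j)
    = t \<bullet> d + (\<Sum>j\<in>UNIV. t $ j *\<^sub>R A $ j) \<bullet> eta + (\<Sum>j\<in>UNIV. t $ j * eps j)"
proof -
  have row: "A $ j \<bullet> eta = (\<Sum>l\<in>UNIV. A $ j $ Inl l * eta $ Inl l)
                   + A $ j $ Inr (tst j) * eta $ Inr (tst j)" for j
  proof -
    have "(\<Sum>g\<in>UNIV. A $ j $ Inr g * eta $ Inr g) = (\<Sum>g\<in>{tst j}. A $ j $ Inr g * eta $ Inr g)"
      using assms by (intro sum.mono_neutral_right) auto
    then show ?thesis
      by (simp add: inner_vec_def UNIV_Plus_UNIV[symmetric] sum.Plus del: UNIV_Plus_UNIV)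
  qed
  have "(\<Sum>j\<in>UNIV. t $ j *\<^sub>R A $ j) \<bullet> eta = (\<Sum>j\<in>UNIV. t $ j * (A $ j \<bullet> eta))"
    by (simp add: inner_sum_left)
  then show ?thesis
    by (simp add: row inner_vec_def[of t] distrib_left sum.distrib)
qed

lemma borel_measurable_nth [measurable]: "(\<lambda>x :: real^'n. x $ i) \<in> borel_measurable borel"
  by (intro borel_measurable_continuous_onI continuous_intros)

lemma borel_measurable_vec:
  assumes "\<And>i. (\<lambda>x. f x $ i) \<in> borel_measurable M"
  shows "(f :: 'a \<Rightarrow> real^'n) \<in> borel_measurable M"
  using assms by (subst borel_measurable_euclidean_space) (auto simp: Basis_vec_def inner_axis)

text \<open>
  By the splitting above and independence, the moment generating function is the product of those of the
  factors and of the single errors.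
\<close>

lemma mgf_two_tier_law:
  fixes A :: "real^('l::finite + 'g::finite)^'j::finite" and S :: "real^'l^'l"
  assumes A: "\<forall>j g. g \<noteq> tst j \<longrightarrow> A $ j $ Inr g = 0"
    and S: "positive_definite S" and lam: "\<forall>j. lam $ j > 0"
  defines "F \<equiv> factor_cov S :: real^('l + 'g)^('l + 'g)"
  defines "s \<equiv> \<lambda>t. \<Sum>j\<in>UNIV. t $ j *\<^sub>R A $ j"
  shows "(\<integral>\<^sup>+y. ennreal (exp (t \<bullet> y)) \<partial>two_tier_law tst A d S lam)
    = ennreal (exp (t \<bullet> d + (s t \<bullet> (F *v s t) + (\<Sum>j\<in>UNIV. lam $ j * (t $ j)\<^sup>2)) / 2)) * gauss_mass F"
proof -
  define E where "E j = density lborel (\<lambda>x. ennreal (normal_density 0 (sqrt (lam $ j)) x))" for j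
  let ?N = "multivariate_normal 0 F"
  let ?P = "\<Pi>\<^sub>M j\<in>UNIV. E j"
  let ?Y = "\<lambda>(eta, eps). \<chi> j. d $ j + (\<Sum>l\<in>UNIV. A $ j $ Inl l * eta $ Inl l)
                           + A $ j $ Inr (tst j) * eta $ Inr (tst j) + eps j"
  have E: "prob_space (E j)" for j
    unfolding E_def using lam by (intro prob_space_normal_density) simp
  have [measurable_cong]: "sets (E j) = sets borel" for j
    by (simp add: E_def)
  interpret P: prob_space ?P
    by (rule prob_space_PiM) (rule E)
  interpret PS: product_sigma_finite E
    by (intro product_sigma_finite.intro prob_space_imp_sigma_finite E)
  have Y: "?Y \<in> borel_measurable (?N \<Otimes>\<^sub>M ?P)"
    by (rule borel_measurable_vec) (simp add: case_prod_beta)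
  have "(\<integral>\<^sup>+y. ennreal (exp (t \<bullet> y)) \<partial>two_tier_law tst A d S lam)
      = (\<integral>\<^sup>+p. ennreal (exp (t \<bullet> ?Y p)) \<partial>(?N \<Otimes>\<^sub>M ?P))"
    unfolding two_tier_law_def F_def[symmetric] E_def[symmetric]
    by (rule nn_integral_distr) (use Y in simp_all)
  also have "\<dots> = (\<integral>\<^sup>+eta. \<integral>\<^sup>+eps. ennreal (exp (t \<bullet> ?Y (eta, eps))) \<partial>?P \<partial>?N)"
    by (rule P.nn_integral_fst[symmetric]) (use Y in measurable)
  also have "\<dots> = (\<integral>\<^sup>+eta. ennreal (exp (t \<bullet> d) * exp (s t \<bullet> eta)) *
      (\<integral>\<^sup>+eps. (\<Prod>j\<in>UNIV. ennreal (exp (t $ j * eps j))) \<partial>?P) \<partial>?N)"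
  proof (rule nn_integral_cong)
    fix eta :: "real^('l + 'g)"
    have "ennreal (exp (t \<bullet> ?Y (eta, eps)))
        = ennreal (exp (t \<bullet> d) * exp (s t \<bullet> eta)) * (\<Prod>j\<in>UNIV. ennreal (exp (t $ j * eps j)))" for eps
      using two_tier_combination[OF A, of t d eta eps]
      by (simp add: s_def exp_add exp_sum prod_ennreal ennreal_mult prod_nonneg)
    then show "(\<integral>\<^sup>+eps. ennreal (exp (t \<bullet> ?Y (eta, eps))) \<partial>?P)
        = ennreal (exp (t \<bullet> d) * exp (s t \<bullet> eta)) *
      (\<integral>\<^sup>+eps. (\<Prod>j\<in>UNIV. ennreal (exp (t $ j * eps j))) \<partial>?P)"
      by (simp add: nn_integral_cmult)
  qed
  also have "(\<integral>\<^sup>+eps. (\<Prod>j\<in>UNIV. ennreal (exp (t $ j * eps j))) \<partial>?P)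
      = (\<Prod>j\<in>UNIV. \<integral>\<^sup>+x. ennreal (exp (t $ j * x)) \<partial>E j)"
    by (rule PS.product_nn_integral_prod) auto
  also have "\<dots> = ennreal (exp ((\<Sum>j\<in>UNIV. lam $ j * (t $ j)\<^sup>2) / 2))"
    using lam by (simp add: E_def mgf_normal prod_ennreal exp_sum sum_divide_distrib)
  also have "(\<integral>\<^sup>+eta. ennreal (exp (t \<bullet> d) * exp (s t \<bullet> eta)) *
        ennreal (exp ((\<Sum>j\<in>UNIV. lam $ j * (t $ j)\<^sup>2) / 2)) \<partial>?N)
      = (\<integral>\<^sup>+eta. ennreal (exp (t \<bullet> d) * exp ((\<Sum>j\<in>UNIV. lam $ j * (t $ j)\<^sup>2) / 2)) *
          ennreal (exp (s t \<bullet> eta)) \<partial>?N)"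
    by (intro nn_integral_cong) (simp add: mult_ac flip: ennreal_mult)
  also have "\<dots> = ennreal (exp (t \<bullet> d) * exp ((\<Sum>j\<in>UNIV. lam $ j * (t $ j)\<^sup>2) / 2)) *
      (\<integral>\<^sup>+eta. ennreal (exp (s t \<bullet> eta)) \<partial>?N)"
    by (rule nn_integral_cmult) simp
  also have "(\<integral>\<^sup>+eta. ennreal (exp (s t \<bullet> eta)) \<partial>?N)
      = ennreal (exp (s t \<bullet> (F *v s t) / 2)) * gauss_mass F"
    unfolding F_def by (rule mgf_multivariate_normal[OF pd_factor_cov(1)[OF S]])
  finally have "(\<integral>\<^sup>+y. ennreal (exp (t \<bullet> y)) \<partial>two_tier_law tst A d S lam)
      = ennreal (exp (t \<bullet> d) * exp ((\<Sum>j\<in>UNIV. lam $ j * (t $ j)\<^sup>2) / 2)) *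
        (ennreal (exp (s t \<bullet> (F *v s t) / 2)) * gauss_mass F)" .
  also have "\<dots> = ennreal (exp (t \<bullet> d) * exp ((\<Sum>j\<in>UNIV. lam $ j * (t $ j)\<^sup>2) / 2) *
        exp (s t \<bullet> (F *v s t) / 2)) * gauss_mass F"
    by (simp only: mult.assoc[symmetric] ennreal_mult[symmetric] exp_ge_zero mult_nonneg_nonneg)
  finally show ?thesis
    by (simp only: mult_exp_exp add_divide_distrib add.assoc add.commute[of "(\<Sum>j\<in>UNIV. _ j) / 2"])
qed

text \<open>
  At \<open>t = 0\<close> the two moment generating functions give the same mass, which then cancels for all \<open>t\<close>.
  The linear part of the exponent is odd and the quadratic part even, so they can be compared
  separately; the quadratic part determines its symmetric matrix by polarization.
\<close>

lemma two_tier_law_moments: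
  fixes A A' :: "real^('l::finite + 'g::finite)^'j::finite" and S S' :: "real^'l^'l"
  assumes A: "\<forall>j g. g \<noteq> tst j \<longrightarrow> A $ j $ Inr g = 0" "\<forall>j g. g \<noteq> tst j \<longrightarrow> A' $ j $ Inr g = 0"
    and S: "positive_definite S" "positive_definite S'"
    and lam: "\<forall>j. lam $ j > 0" "\<forall>j. lam' $ j > 0"
    and law: "two_tier_law tst A' d' S' lam' = two_tier_law tst A d S lam"
  shows "d = d'"
    and "A $ i \<bullet> (factor_cov S *v A $ k) + of_bool (i = k) * lam $ i
       = A' $ i \<bullet> (factor_cov S' *v A' $ k) + of_bool (i = k) * lam' $ i"
proof -
  let ?F = "factor_cov S :: real^('l + 'g)^('l + 'g)"
  let ?F' = "factor_cov S' :: real^('l + 'g)^('l + 'g)"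
  define s where "s t = (\<Sum>j\<in>UNIV. t $ j *\<^sub>R A $ j)" for t
  define s' where "s' t = (\<Sum>j\<in>UNIV. t $ j *\<^sub>R A' $ j)" for t
  define q where "q t = s t \<bullet> (?F *v s t) + (\<Sum>j\<in>UNIV. lam $ j * (t $ j)\<^sup>2)" for t
  define q' where "q' t = s' t \<bullet> (?F' *v s' t) + (\<Sum>j\<in>UNIV. lam' $ j * (t $ j)\<^sup>2)" for t
  have mgf: "ennreal (exp (t \<bullet> d + q t / 2)) * gauss_mass ?F
      = ennreal (exp (t \<bullet> d' + q' t / 2)) * gauss_mass ?F'" for t
    using mgf_two_tier_law[OF A(1) S(1) lam(1), where t = t and d = d]
      mgf_two_tier_law[OF A(2) S(2) lam(2), where t = t and d = d'] law
    by (simp add: q_def q'_def s_def s'_def)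
  have s0: "s 0 = 0" "s' 0 = 0" by (simp_all add: s_def s'_def)
  have mass: "gauss_mass ?F = gauss_mass ?F'"
    using mgf[of 0] by (simp add: q_def q'_def s0)
  have *: "t \<bullet> d + q t / 2 = t \<bullet> d' + q' t / 2" for t
  proof -
    have "ennreal (exp (t \<bullet> d + q t / 2)) = ennreal (exp (t \<bullet> d' + q' t / 2))"
      using mgf[of t] gauss_mass_finite_nonzero[of ?F] pd_factor_cov(1)[OF S(1)]
      unfolding mass[symmetric] by (auto simp: mult.commute[of _ "gauss_mass _"] ennreal_mult_cancel_left)
    then show ?thesis by simp
  qed
  have neg: "s (- t) = - s t" "s' (- t) = - s' t" for t
    by (simp_all add: s_def s'_def sum_negf)
  have even: "q (- t) = q t" "q' (- t) = q' t" for t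
    by (simp_all add: q_def q'_def neg vec.neg)
  have "t \<bullet> d = t \<bullet> d'" for t
    using *[of t] *[of "- t"] even[of t] by simp
  then show "d = d'" using vector_eq_ldot by blast
  then have qq: "q t = q' t" for t using *[of t] by simp
  have sx: "s (axis i 1) = A $ i" "s' (axis i 1) = A' $ i" for i
    by (simp_all add: s_def s'_def axis_def if_distrib[of "\<lambda>x. x *\<^sub>R _"] cong: if_cong)
  have sxx: "s (axis i 1 + axis k 1) = A $ i + A $ k" "s' (axis i 1 + axis k 1) = A' $ i + A' $ k" for i k
    using sx[of i] sx[of k] by (simp_all add: s_def s'_def scaleR_add_left sum.distrib)
  have lx: "(\<Sum>j\<in>UNIV. v $ j * ((axis i 1 :: real^'j) $ j)\<^sup>2) = v $ i" for v :: "real^'j" and i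
    by (simp add: axis_def if_distrib[of "\<lambda>x. x\<^sup>2"] if_distrib[of "\<lambda>x. _ * x"] cong: if_cong)
  have diag: "A $ i \<bullet> (?F *v A $ i) + lam $ i = A' $ i \<bullet> (?F' *v A' $ i) + lam' $ i" for i
    using qq[of "axis i 1"] by (simp add: q_def q'_def sx lx)
  show "A $ i \<bullet> (?F *v A $ k) + of_bool (i = k) * lam $ i
       = A' $ i \<bullet> (?F' *v A' $ k) + of_bool (i = k) * lam' $ i"
  proof (cases "i = k")
    case False
    \<comment> \<open>The cross term vanishes for \<open>i \<noteq> k\<close>, so the errors contribute nothing to the polarization.\<close>
    have lxx: "(\<Sum>j\<in>UNIV. v $ j * ((axis i 1 + axis k 1 :: real^'j) $ j)\<^sup>2) = v $ i + v $ k" for v :: "real^'j"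
    proof -
      have "v $ j * ((axis i 1 + axis k 1 :: real^'j) $ j)\<^sup>2
          = v $ j * ((axis i 1 :: real^'j) $ j)\<^sup>2 + v $ j * ((axis k 1 :: real^'j) $ j)\<^sup>2" for j
        using False by (simp add: axis_def)
      then show ?thesis by (simp only: sum.distrib lx)
    qed
    show ?thesis
      using qq[of "axis i 1 + axis k 1"] diag[of i] diag[of k] False
        pd_sym[OF pd_factor_cov(1)[OF S(1)], of "A $ i" "A $ k"]
        pd_sym[OF pd_factor_cov(1)[OF S(2)], of "A' $ i" "A' $ k"]
      by (simp add: q_def q'_def sxx lxx inner_add_left inner_add_right matrix_vector_right_distrib
          del: vector_add_component)
  qed (use diag in simp)
qed

lemma testlet_covariance:
  fixes X :: "real^('l::finite + 'g::finite)^'j"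
  assumes "\<forall>j g. g \<noteq> tst j \<longrightarrow> X $ j $ Inr g = 0"
  shows "(\<Sum>g\<in>UNIV. X $ i $ Inr g * X $ k $ Inr g)
    = of_bool (tst i = tst k) * (X $ i $ Inr (tst i) * X $ k $ Inr (tst k))"
proof -
  have "(\<Sum>g\<in>UNIV. X $ i $ Inr g * X $ k $ Inr g) = (\<Sum>g\<in>{tst i}. X $ i $ Inr g * X $ k $ Inr g)"
    using assms by (intro sum.mono_neutral_right) auto
  then show ?thesis using assms by auto
qed

section \<open>Full column rank and spanning rows\<close>

text \<open>
  If the columns in \<open>C\<close> are independent, then the rows, restricted to these columns, span the
  coordinate space of \<open>C\<close>; in particular each unit vector is a combination of them.  This turns every rank condition
  on \<open>A\<close> into a solvable system for weights on the items.
\<close>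

lemma full_column_rank_solve:
  fixes X :: "real^'n^'m"
  assumes "full_column_rank X R C" and "k \<in> C"
  obtains w :: "'m \<Rightarrow> real" where "\<And>k'. k' \<in> C \<Longrightarrow> (\<Sum>i\<in>R. w i * X $ i $ k') = of_bool (k' = k)"
proof -
  define Y where "Y = submat X R C"
  define E :: "(real^'n) set" where "E = (\<lambda>k. axis k 1) ` C"
  have E: "E \<subseteq> Basis" and cardE: "card E = card C"
    by (auto simp: E_def Basis_vec_def axis_eq_axis inj_on_def intro!: card_image)
  have dimE: "dim (span E) = card C"
    using dim_eq_card_independent[OF independent_mono[OF independent_Basis E]] cardE by simp
  have Y: "Y $ i = (\<Sum>k\<in>C. Y $ i $ k *\<^sub>R axis k 1)" for i
    by (auto simp: vec_eq_iff Y_def submat_def axis_def if_distrib[of "\<lambda>x. _ * x"] cong: if_cong)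
  have "Y $ i \<in> span E" for i
    by (subst Y, intro span_sum span_scale span_base) (auto simp: E_def)
  then have sub: "span (rows Y) \<subseteq> span E"
    by (intro span_minimal) (auto simp: rows_def row_def vec_lambda_eta)
  have "dim (span (rows Y)) = card C"
    using assms(1) by (simp add: full_column_rank_def row_rank_def Y_def)
  then have "span (rows Y) = span E"
    using sub dimE by (intro subspace_dim_equal) auto
  then have "axis k 1 \<in> span (rows Y)"
    using assms(2) by (auto simp: E_def span_base)
  moreover have "rows Y = range (\<lambda>i. Y $ i)"
    by (auto simp: rows_def row_def vec_lambda_eta)
  ultimately have "axis k 1 \<in> span (range (\<lambda>i. Y $ i))"
    by simp
  then have "axis k 1 \<in> range (\<lambda>u. \<Sum>v\<in>range (\<lambda>i. Y $ i). u v *\<^sub>R v)"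
    by (subst (asm) span_finite) auto
  then obtain u where u: "axis k 1 = (\<Sum>v\<in>range (\<lambda>i. Y $ i). u v *\<^sub>R v)"
    by auto
  \<comment> \<open>Equal rows of \<open>Y\<close> appear only once in its range; all the weight of such a class goes to one
    representative \<open>h v\<close>.\<close>
  obtain h where h: "\<And>v. v \<in> range (\<lambda>i. Y $ i) \<Longrightarrow> Y $ (h v) = v"
    by (metis (full_types) f_inv_into_f)
  define w where "w i = (if i \<in> h ` range (\<lambda>i. Y $ i) then u (Y $ i) else 0)" for i
  have injh: "inj_on h (range (\<lambda>i. Y $ i))"
    by (metis h inj_onI)
  have "axis k 1 = (\<Sum>i\<in>h ` range (\<lambda>i. Y $ i). u (Y $ i) *\<^sub>R Y $ i)"
    unfolding u by (subst sum.reindex[OF injh]) (auto intro!: sum.cong simp: h)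
  also have "\<dots> = (\<Sum>i\<in>UNIV. w i *\<^sub>R Y $ i)"
    by (rule sum.mono_neutral_cong_left) (auto simp: w_def)
  finally have ax: "axis k 1 = (\<Sum>i\<in>UNIV. w i *\<^sub>R Y $ i)" .
  have "(\<Sum>i\<in>R. w i * X $ i $ k') = of_bool (k' = k)" if "k' \<in> C" for k'
  proof -
    have "of_bool (k' = k) = (axis k 1 :: real^'n) $ k'"
      by (simp add: axis_def)
    also have "\<dots> = (\<Sum>i\<in>UNIV. w i * Y $ i $ k')"
      unfolding ax by simp
    also have "\<dots> = (\<Sum>i\<in>R. w i * X $ i $ k')"
      using that by (intro sum.mono_neutral_cong_right) (auto simp: Y_def submat_def)
    finally show ?thesis by simp
  qed
  then show ?thesis using that by blast
qed

lemma span_UNIV_if_axis: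
  fixes V :: "(real^'n) set"
  assumes "\<And>k. axis k 1 \<in> span V"
  shows "span V = UNIV"
proof -
  have "Basis \<subseteq> span V" using assms by (auto simp: Basis_vec_def)
  then show ?thesis by (metis span_Basis span_mono span_span top.extremum_unique)
qed

text \<open>
  The map \<open>h\<close> selects the columns to be kept: it is the identity for whole rows of \<open>A\<close>, and
  \<open>Inl\<close> for main loadings.
\<close>

lemma full_column_rank_span:
  fixes X :: "real^'n^'m" and h :: "'k::finite \<Rightarrow> 'n"
  assumes "full_column_rank X R C" "inj h" "range h \<subseteq> C"
  shows "span ((\<lambda>i. \<chi> l. X $ i $ h l) ` R) = UNIV"
proof (rule span_UNIV_if_axis)
  fix l
  obtain w where w: "\<And>k'. k' \<in> C \<Longrightarrow> (\<Sum>i\<in>R. w i * X $ i $ k') = of_bool (k' = h l)"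
    using full_column_rank_solve[OF assms(1), of "h l"] assms(3) by blast
  have "axis l 1 = (\<Sum>i\<in>R. w i *\<^sub>R (\<chi> l. X $ i $ h l))"
    using w assms(2,3) by (auto simp: vec_eq_iff axis_def inj_eq image_subset_iff)
  also have "\<dots> \<in> span ((\<lambda>i. \<chi> l. X $ i $ h l) ` R)"
    by (intro span_sum span_scale span_base) auto
  finally show "axis l 1 \<in> span ((\<lambda>i. \<chi> l. X $ i $ h l) ` R)" .
qed

section \<open>Factorizations with equal cross-covariances\<close>

text \<open>
  The forms below are evaluated along linear maps, so two of them agree everywhere as soon as they agree
  on spanning sets.
\<close>

lemma linear_form_left: "linear T \<Longrightarrow> linear (\<lambda>x. T x \<bullet> (S *v y))"
  for S :: "real^'n^'m"
  by (auto intro!: linearI simp: linear_add linear_cmul inner_left_distrib)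

lemma linear_form_right: "linear U \<Longrightarrow> linear (\<lambda>y. x \<bullet> (S *v U y))"
  for S :: "real^'n^'m"
  by (auto intro!: linearI simp: linear_add linear_cmul inner_right_distrib matrix_vector_right_distrib
      matrix_vector_mult_scaleR)

lemma form_extend_left:
  fixes S :: "real^'n^'m" and S' :: "real^'k^'l"
  assumes "linear T" "linear T'" "span V = UNIV"
    and "\<And>x. x \<in> V \<Longrightarrow> T x \<bullet> (S *v y) = T' x \<bullet> (S' *v y')"
  shows "T x \<bullet> (S *v y) = T' x \<bullet> (S' *v y')"
  by (rule linear_eq_on_span[of "\<lambda>x. T x \<bullet> (S *v y)" "\<lambda>x. T' x \<bullet> (S' *v y')" V])
     (use assms in \<open>auto intro: linear_form_left\<close>)

lemma form_extend_right:
  fixes S :: "real^'n^'m" and S' :: "real^'k^'l"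
  assumes "linear U" "linear U'" "span V = UNIV"
    and "\<And>y. y \<in> V \<Longrightarrow> x \<bullet> (S *v U y) = x' \<bullet> (S' *v U' y)"
  shows "x \<bullet> (S *v U y) = x' \<bullet> (S' *v U' y)"
  by (rule linear_eq_on_span[of "\<lambda>y. x \<bullet> (S *v U y)" "\<lambda>y. x' \<bullet> (S' *v U' y)" V])
     (use assms in \<open>auto intro: linear_form_right\<close>)

text \<open>
  The \<open>f i\<close> with \<open>i \<in> Q\<close> need not be independent, so no linear map needs to send every \<open>f i\<close> to \<open>f' i\<close>.
  This can be arranged on a basis \<open>C\<close> chosen among them, with \<open>q v\<close> an item whose vector is \<open>v\<close>.
\<close>

lemma linear_map_on_spanning_family:
  fixes f :: "'j \<Rightarrow> real^'n"
  assumes "span (f ` Q) = UNIV"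
  obtains C q U where "span C = UNIV" "linear U"
    "\<And>v. v \<in> C \<Longrightarrow> q v \<in> Q \<and> f (q v) = v \<and> U v = (f' (q v) :: real^'n)"
proof -
  obtain C where C: "C \<subseteq> f ` Q" "independent C" "span (f ` Q) \<subseteq> span C"
    using maximal_independent_subset[of "f ` Q"] span_mono span_span by (metis span_minimal subspace_span)
  obtain q where q: "\<And>v. v \<in> C \<Longrightarrow> q v \<in> Q \<and> f (q v) = v"
    using C(1) by (metis (full_types) f_inv_into_f inv_into_into subset_iff)
  obtain U where "linear U" "\<And>v. v \<in> C \<Longrightarrow> U v = f' (q v)"
    using linear_independent_extend[OF C(2), of "\<lambda>v. f' (q v)"] by blast
  then show ?thesis
    using that[of C U q] q C(3) assms by auto
qed

text \<open>
  Define \<open>T\<close> and \<open>U\<close> by \<open>f i \<mapsto> f' i\<close> on bases chosen from \<open>P\<close> and from \<open>Q\<close>.  By bilinearity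
  \<open>x \<bullet> (S *v y) = T x \<bullet> (S' *v U y)\<close> for all \<open>x\<close>, \<open>y\<close>; as the left form is nondegenerate, \<open>T\<close> and \<open>U\<close>
  are injective, hence bijective.  An item whose covariances with \<open>Q\<close> are preserved then has
  \<open>f' i\<close> and \<open>T (f i)\<close> with the same products against the range of \<open>U\<close>, that is, against everything,
  and so they are equal.  The item may lie outside \<open>P\<close>, which is how the result is mostly used.
\<close>

lemma cross_covariance_transfer:
  fixes f f' :: "'j \<Rightarrow> real^'n" and S S' :: "real^'n^'n"
  assumes pd: "positive_definite S" "positive_definite S'"
    and sp: "span (f ` P) = UNIV" "span (f ` Q) = UNIV"
    and eq: "\<forall>i\<in>P. \<forall>j\<in>Q. f i \<bullet> (S *v f j) = f' i \<bullet> (S' *v f' j)"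
  shows "\<exists>T U. linear T \<and> linear U \<and> surj T \<and> surj U \<and>
    (\<forall>x y. x \<bullet> (S *v y) = T x \<bullet> (S' *v U y)) \<and>
    (\<forall>i. (\<forall>j\<in>Q. f i \<bullet> (S *v f j) = f' i \<bullet> (S' *v f' j)) \<longrightarrow> f' i = T (f i)) \<and>
    (\<forall>i. (\<forall>j\<in>P. f j \<bullet> (S *v f i) = f' j \<bullet> (S' *v f' i)) \<longrightarrow> f' i = U (f i))"
proof -
  obtain B p T where T: "span B = UNIV" "linear T"
    "\<And>v. v \<in> B \<Longrightarrow> p v \<in> P \<and> f (p v) = v \<and> T v = f' (p v)"
    using linear_map_on_spanning_family[OF sp(1), of f'] by metis
  obtain C q U where U: "span C = UNIV" "linear U"
    "\<And>v. v \<in> C \<Longrightarrow> q v \<in> Q \<and> f (q v) = v \<and> U v = f' (q v)"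
    using linear_map_on_spanning_family[OF sp(2), of f'] by metis
  have "id x \<bullet> (S *v y) = T x \<bullet> (S' *v U y)" if "y \<in> C" for x y
  proof (rule form_extend_left[OF linear_id T(2) T(1)])
    fix x assume "x \<in> B"
    then show "id x \<bullet> (S *v y) = T x \<bullet> (S' *v U y)"
      using eq[rule_format, of "p x" "q y"] T(3)[of x] U(3)[of y] that by auto
  qed
  note * = this
  have "x \<bullet> (S *v id y) = T x \<bullet> (S' *v U y)" for x y
    by (rule form_extend_right[OF linear_id U(2) U(1)]) (use * in auto)
  then have TU: "x \<bullet> (S *v y) = T x \<bullet> (S' *v U y)" for x y
    by simp
  have "x = 0" if "T x = 0" for x
    using TU[of x x] that pd_zero[OF pd(1)] by simp
  then have "inj T" using T(2) by (simp add: linear_injective_0)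
  then have surjT: "surj T" using linear_injective_imp_surjective[OF T(2)] by blast 
  have "x = 0" if "U x = 0" for x
    using TU[of x x] that pd_zero[OF pd(1)] by simp
  then have "inj U" using U(2) by (simp add: linear_injective_0)
  then have surjU: "surj U" using linear_injective_imp_surjective[OF U(2)] by blast
  have 1: "f' i = T (f i)" if "\<And>j. j \<in> Q \<Longrightarrow> f i \<bullet> (S *v f j) = f' i \<bullet> (S' *v f' j)" for i
  proof -
    have "f i \<bullet> (S *v id y) = f' i \<bullet> (S' *v U y)" for y
    proof (rule form_extend_right[OF linear_id U(2) U(1)])
      fix y assume "y \<in> C"
      then show "f i \<bullet> (S *v id y) = f' i \<bullet> (S' *v U y)"
        using U(3)[of y] that[of "q y"] by simp
    qed
    then have *: "(f' i - T (f i)) \<bullet> (S' *v U y) = 0" for y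
      using TU[of "f i" y] by (simp add: inner_diff_left)
    obtain y where "f' i - T (f i) = U y" using surjU by (metis surjD)
    then show ?thesis using *[of y] pd_zero[OF pd(2), of "f' i - T (f i)"] by simp
  qed
  have 2: "f' i = U (f i)" if "\<And>j. j \<in> P \<Longrightarrow> f j \<bullet> (S *v f i) = f' j \<bullet> (S' *v f' i)" for i
  proof -
    have "id x \<bullet> (S *v f i) = T x \<bullet> (S' *v f' i)" for x
    proof (rule form_extend_left[OF linear_id T(2) T(1)])
      fix x assume "x \<in> B"
      then show "id x \<bullet> (S *v f i) = T x \<bullet> (S' *v f' i)"
        using T(3)[of x] that[of "p x"] by simp
    qed
    then have *: "T x \<bullet> (S' *v (f' i - U (f i))) = 0" for x
      using TU[of x "f i"] by (simp add: inner_diff_right matrix_vector_mult_diff_distrib)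
    obtain x where "f' i - U (f i) = T x" using surjT by (metis surjD)
    then show ?thesis using *[of x] pd_zero[OF pd(2), of "f' i - U (f i)"] by simp
  qed
  show ?thesis
    by (intro exI[of _ T] exI[of _ U] conjI allI impI T(2) U(2) surjT surjU TU 1 2) blast+
qed

text \<open>
  Item \<open>j\<close> lies in neither \<open>P\<close> nor \<open>Q\<close>, so all its covariances with these sets are off-diagonal
  and preserved.  Therefore both \<open>T\<close> and \<open>U\<close> send \<open>a j\<close> to \<open>a' j\<close>, and the relation between the two forms
  can be read at the diagonal place \<open>(j, j)\<close>.
\<close>

lemma communality_unique:
  fixes a a' :: "'j \<Rightarrow> real^'n" and S S' :: "real^'n^'n"
  assumes pd: "positive_definite S" "positive_definite S'"
    and sp: "span (a ` P) = UNIV" "span (a ` Q) = UNIV"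
    and disj: "P \<inter> Q = {}" "j \<notin> P" "j \<notin> Q"
    and eq: "\<And>i k. i \<noteq> k \<Longrightarrow> a i \<bullet> (S *v a k) = a' i \<bullet> (S' *v a' k)"
  shows "a j \<bullet> (S *v a j) = a' j \<bullet> (S' *v a' j)"
proof -
  have "\<forall>i\<in>P. \<forall>j\<in>Q. a i \<bullet> (S *v a j) = a' i \<bullet> (S' *v a' j)"
    by (intro ballI eq) (use disj in auto)
  from cross_covariance_transfer[OF pd sp this]
  obtain T U where lin: "linear T" "linear U" and surjT: "surj T"
    and TU: "\<forall>x y. x \<bullet> (S *v y) = T x \<bullet> (S' *v U y)"
    and T: "\<forall>i. (\<forall>j\<in>Q. a i \<bullet> (S *v a j) = a' i \<bullet> (S' *v a' j)) \<longrightarrow> a' i = T (a i)"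
    and U: "\<forall>i. (\<forall>j\<in>P. a j \<bullet> (S *v a i) = a' j \<bullet> (S' *v a' i)) \<longrightarrow> a' i = U (a i)"
    by (elim exE conjE) (rule that)
  have "a' j = T (a j)" "a' j = U (a j)"
    by (intro T[rule_format] U[rule_format] eq; use disj in auto)+
  with TU show ?thesis by simp
qed

section \<open>Isometry of the main factors\<close>

text \<open>
  The transfer between the first two testlets gives \<open>T\<close> and \<open>U\<close>.  Every item is outside one of the
  two testlets and follows the corresponding map; the items of the third testlet follow both, and they
  span, so \<open>T = U\<close>.
\<close>

lemma isometry_from_three_testlets:
  fixes f f' :: "'j \<Rightarrow> real^'n" and S S' :: "real^'n^'n"
  assumes pd: "positive_definite S" "positive_definite S'"
    and sp: "span (f ` items tst {g1}) = UNIV" "span (f ` items tst {g2}) = UNIV"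
      "span (f ` items tst {g3}) = UNIV"
    and ne: "g1 \<noteq> g2" "g1 \<noteq> g3" "g2 \<noteq> g3"
    and eq: "\<And>i j. tst i \<noteq> tst j \<Longrightarrow> f i \<bullet> (S *v f j) = f' i \<bullet> (S' *v f' j)"
  shows "\<exists>T. linear T \<and> (\<forall>i. f' i = T (f i)) \<and> (\<forall>x y. x \<bullet> (S *v y) = T x \<bullet> (S' *v T y))"
proof -
  have "\<forall>i\<in>items tst {g1}. \<forall>j\<in>items tst {g2}. f i \<bullet> (S *v f j) = f' i \<bullet> (S' *v f' j)"
    using ne eq by (auto simp: items_def)
  from cross_covariance_transfer[OF pd sp(1,2) this]
  obtain T U where lin: "linear T" "linear U" and surjT: "surj T"
    and TU: "\<forall>x y. x \<bullet> (S *v y) = T x \<bullet> (S' *v U y)"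
    and T: "\<forall>i. (\<forall>j\<in>items tst {g2}. f i \<bullet> (S *v f j) = f' i \<bullet> (S' *v f' j)) \<longrightarrow> f' i = T (f i)"
    and U: "\<forall>i. (\<forall>j\<in>items tst {g1}. f j \<bullet> (S *v f i) = f' j \<bullet> (S' *v f' i)) \<longrightarrow> f' i = U (f i)"
    by (elim exE conjE) (rule that)
  have T': "f' i = T (f i)" if "tst i \<noteq> g2" for i
    using that by (intro T[rule_format] eq) (auto simp: items_def)
  have U': "f' i = U (f i)" if "tst i \<noteq> g1" for i
    using that by (intro U[rule_format] eq) (auto simp: items_def)
  have "T x = U x" for x
    by (rule linear_eq_on_span[OF lin, of "f ` items tst {g3}"])
       (use sp(3) ne T' U' in \<open>force simp: items_def\<close>)+
  then have "T = U" by blast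
  moreover have "f' i = T (f i)" for i
    using T'[of i] U'[of i] ne \<open>T = U\<close> by metis
  ultimately show ?thesis using TU lin by blast
qed

text \<open>
  Within a testlet \<open>g \<in> G1\<close> the covariance is the main part plus \<open>b i * b j\<close>.  The weights \<open>w\<close>
  annihilate the main loadings, hence also their images under \<open>T\<close>.  Applied to the first index they
  leave \<open>b j = c * b' j\<close> on the testlet; applied once more, \<open>c\<^sup>2 = 1\<close>.  So testlet covariances agree in
  \<open>G1\<close>, hence so do the main ones, which makes \<open>T\<close> an isometry.  Comparison with the relation between
  \<open>T\<close> and \<open>U\<close> gives \<open>T = U\<close>.
\<close>

lemma isometry_from_testlet_bipartition:
  fixes f f' :: "'j::finite \<Rightarrow> real^'n" and S S' :: "real^'n^'n" and b b' :: "'j \<Rightarrow> real"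
  assumes pd: "positive_definite S" "positive_definite S'"
    and sp: "span (f ` items tst G1) = UNIV" "span (f ` items tst (- G1)) = UNIV"
    and w: "\<And>g. g \<in> G1 \<Longrightarrow> \<exists>w. (\<Sum>i\<in>items tst G1. w i *\<^sub>R f i) = 0 \<and>
                    (\<Sum>i\<in>items tst {g}. w i * b i) = 1"
    and eq: "\<And>i j. f i \<bullet> (S *v f j) + of_bool (tst i = tst j) * (b i * b j)
                 = f' i \<bullet> (S' *v f' j) + of_bool (tst i = tst j) * (b' i * b' j)"
  shows "\<exists>T. linear T \<and> (\<forall>i. f' i = T (f i)) \<and> (\<forall>x y. x \<bullet> (S *v y) = T x \<bullet> (S' *v T y))"
proof -
  let ?P = "items tst G1" and ?Q = "items tst (- G1)"
  have off: "f i \<bullet> (S *v f j) = f' i \<bullet> (S' *v f' j)" if "tst i \<noteq> tst j" for i j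
    using eq[of i j] that by simp
  have "\<forall>i\<in>?P. \<forall>j\<in>?Q. f i \<bullet> (S *v f j) = f' i \<bullet> (S' *v f' j)"
    by (intro ballI off) (auto simp: items_def)
  from cross_covariance_transfer[OF pd sp this]
  obtain T U where lin: "linear T" "linear U" and surjT: "surj T"
    and TU: "\<forall>x y. x \<bullet> (S *v y) = T x \<bullet> (S' *v U y)"
    and T: "\<forall>i. (\<forall>j\<in>?Q. f i \<bullet> (S *v f j) = f' i \<bullet> (S' *v f' j)) \<longrightarrow> f' i = T (f i)"
    and U: "\<forall>i. (\<forall>j\<in>?P. f j \<bullet> (S *v f i) = f' j \<bullet> (S' *v f' i)) \<longrightarrow> f' i = U (f i)"
    by (elim exE conjE) (rule that)
  have T': "f' i = T (f i)" if "i \<in> ?P" for i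
    using that by (intro T[rule_format] off) (auto simp: items_def)
  have U': "f' i = U (f i)" if "i \<in> ?Q" for i
    using that by (intro U[rule_format] off) (auto simp: items_def)
  have bb: "b i * b j = b' i * b' j" if i: "tst i = g" and j: "tst j = g" and g: "g \<in> G1" for i j g
  proof -
    obtain w where w0: "(\<Sum>i\<in>?P. w i *\<^sub>R f i) = 0" and w1: "(\<Sum>i\<in>items tst {g}. w i * b i) = 1"
      using w[OF g] by blast
    have w0': "(\<Sum>i\<in>?P. w i *\<^sub>R f' i) = 0"
    proof -
      have "(\<Sum>i\<in>?P. w i *\<^sub>R f' i) = (\<Sum>i\<in>?P. T (w i *\<^sub>R f i))"
        by (intro sum.cong) (simp_all add: T' linear_cmul[OF lin(1)])
      also have "\<dots> = T (\<Sum>i\<in>?P. w i *\<^sub>R f i)"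
        by (simp add: linear_sum[OF lin(1)])
      also have "\<dots> = 0" using w0 linear_0[OF lin(1)] by simp
      finally show ?thesis .
    qed
    define c where "c = (\<Sum>i\<in>items tst {g}. w i * b' i)"
    have restrict: "(\<Sum>i\<in>?P. w i * (of_bool (tst i = g) * h i)) = (\<Sum>i\<in>items tst {g}. w i * h i)" for h
      using g by (intro sum.mono_neutral_cong_right) (auto simp: items_def)
    have *: "b j = c * b' j" if j: "tst j = g" for j
    proof -
      have "(\<Sum>i\<in>?P. w i * (f i \<bullet> (S *v f j) + of_bool (tst i = g) * (b i * b j)))
          = (\<Sum>i\<in>?P. w i *\<^sub>R f i) \<bullet> (S *v f j) + (\<Sum>i\<in>items tst {g}. w i * (b i * b j))"
        by (simp add: distrib_left sum.distrib restrict inner_sum_left)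
      also have "\<dots> = b j"
        using w0 w1 by (simp add: mult.assoc[symmetric] sum_distrib_right[symmetric])
      finally have L: "(\<Sum>i\<in>?P. w i * (f i \<bullet> (S *v f j) + of_bool (tst i = g) * (b i * b j))) = b j" .
      have "(\<Sum>i\<in>?P. w i * (f' i \<bullet> (S' *v f' j) + of_bool (tst i = g) * (b' i * b' j)))
          = (\<Sum>i\<in>?P. w i *\<^sub>R f' i) \<bullet> (S' *v f' j) + (\<Sum>i\<in>items tst {g}. w i * (b' i * b' j))"
        by (simp add: distrib_left sum.distrib restrict inner_sum_left)
      also have "\<dots> = c * b' j"
        using w0' by (simp add: c_def mult.assoc[symmetric] sum_distrib_right[symmetric])
      finally show ?thesis
        using L eq[of _ j] j by simp
    qed
    have "1 = (\<Sum>i\<in>items tst {g}. w i * (c * b' i))"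
      unfolding w1[symmetric] by (intro sum.cong) (auto simp: items_def *)
    also have "\<dots> = c * c"
      by (simp add: c_def sum_distrib_left sum_distrib_right mult.left_commute)
    finally have "c * c = 1" by simp
    have "b i * b j = (c * c) * (b' i * b' j)" using *[OF i] *[OF j] by (simp add: algebra_simps)
    then show ?thesis using \<open>c * c = 1\<close> by simp
  qed
  have PP: "f i \<bullet> (S *v f j) = T (f i) \<bullet> (S' *v T (f j))" if "i \<in> ?P" "j \<in> ?P" for i j
  proof (cases "tst i = tst j")
    case True
    then have "b i * b j = b' i * b' j"
      using that by (intro bb[of i "tst i" j]) (auto simp: items_def)
    then show ?thesis
      using eq[of i j] unfolding T'[OF that(1)] T'[OF that(2)] by simp
  next
    case False
    then show ?thesis
      using off[of i j] unfolding T'[OF that(1)] T'[OF that(2)] by simp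
  qed
  have "id x \<bullet> (S *v y) = T x \<bullet> (S' *v T y)" if "y \<in> f ` ?P" for x y
    by (rule form_extend_left[OF linear_id lin(1) sp(1)]) (use that PP in auto)
  note * = this
  have "x \<bullet> (S *v id y) = T x \<bullet> (S' *v T y)" for x y
    by (rule form_extend_right[OF linear_id lin(1) sp(1)]) (use * in auto)
  then have TT: "x \<bullet> (S *v y) = T x \<bullet> (S' *v T y)" for x y by simp
  \<comment> \<open>\<open>T\<close> is surjective, so a vector with zero product against its range vanishes.\<close>
  have "T y = U y" for y
  proof -
    obtain x where x: "T y - U y = T x" using surjT by (metis surjD)
    have "T x \<bullet> (S' *v (T y - U y)) = 0"
      using TT[of x y] TU[rule_format, of x y] by (simp add: inner_diff_right matrix_vector_mult_diff_distrib)
    then show ?thesis using pd_zero[OF pd(2), of "T y - U y"] x by simp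
  qed
  then have "f' i = T (f i)" for i
    using T'[of i] U'[of i] by (cases "i \<in> ?P") (auto simp: items_def)
  then show ?thesis using TT lin(1) by blast
qed

text \<open>
  An item that loads on main factor \<open>l\<close> alone can load on no other one in \<open>f'\<close>; thus \<open>T\<close> multiplies the
  \<open>l\<close>-th unit vector by a scalar, whose square is \<open>1\<close> because both factor variances are \<open>1\<close>.
\<close>

lemma isometry_diagonal:
  fixes f f' :: "'j \<Rightarrow> real^'l" and S S' :: "real^'l^'l"
  assumes T: "linear T" "\<And>i. f' i = T (f i)" "\<And>x y. x \<bullet> (S *v y) = T x \<bullet> (S' *v T y)"
    and unit: "\<And>l. S $ l $ l = 1" "\<And>l. S' $ l $ l = 1"
    and ident: "\<And>l. \<exists>j. f j $ l \<noteq> 0 \<and> (\<forall>l'. l' \<noteq> l \<longrightarrow> f j $ l' = 0)"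
    and pattern: "\<And>j l. f j $ l = 0 \<Longrightarrow> f' j $ l = 0"
  obtains c where "\<And>l. T (axis l 1) = c l *\<^sub>R axis l 1" "\<And>l. c l * c l = 1"
    "\<And>i l. f' i $ l = c l * f i $ l"
proof -
  have entry: "X $ l $ l = axis l 1 \<bullet> (X *v axis l 1)" for X :: "real^'l^'l" and l
    by (simp add: matrix_vector_mul_component inner_axis' inner_axis)
  have "\<exists>c. T (axis l 1) = c *\<^sub>R axis l 1 \<and> c * c = 1" for l
  proof -
    obtain j where j: "f j $ l \<noteq> 0" "\<And>l'. l' \<noteq> l \<Longrightarrow> f j $ l' = 0"
      using ident[of l] by blast
    have "f j = f j $ l *\<^sub>R axis l 1"
      using j by (auto simp: vec_eq_iff axis_def)
    then have f': "f' j = f j $ l *\<^sub>R T (axis l 1)"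
      by (metis T(1,2) linear_cmul)
    have "T (axis l 1) $ l' = 0" if "l' \<noteq> l" for l'
      using pattern[OF j(2)[OF that]] j(1) by (simp add: f')
    then have c: "T (axis l 1) = T (axis l 1) $ l *\<^sub>R axis l 1"
      by (auto simp: vec_eq_iff axis_def)
    define c where "c = T (axis l 1) $ l"
    have "1 = T (axis l 1) \<bullet> (S' *v T (axis l 1))"
      using T(3)[of "axis l 1" "axis l 1"] unit(1)[of l] entry[of S l] by simp
    also have "T (axis l 1) = c *\<^sub>R axis l 1" using c by (simp add: c_def)
    finally have "c * c * (axis l 1 \<bullet> (S' *v axis l 1)) = 1"
      by (simp add: matrix_vector_mult_scaleR)
    then have "c * c = 1" using unit(2)[of l] entry[of S' l] by simp
    then show ?thesis using c by (auto simp: c_def)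
  qed
  then obtain c where c: "\<And>l. T (axis l 1) = c l *\<^sub>R axis l 1" "\<And>l. c l * c l = 1"
    by metis
  have "f' i $ l = c l * f i $ l" for i l
  proof -
    have "f i = (\<Sum>k\<in>UNIV. f i $ k *\<^sub>R axis k 1)"
      by (simp add: vec_eq_iff axis_def if_distrib[of "\<lambda>x. _ * x"] cong: if_cong)
    then have "f' i = T (\<Sum>k\<in>UNIV. f i $ k *\<^sub>R axis k 1)" using T(2) by metis
    also have "\<dots> = (\<Sum>k\<in>UNIV. f i $ k *\<^sub>R c k *\<^sub>R axis k 1)"
      by (simp add: linear_sum[OF T(1)] linear_cmul[OF T(1)] c(1))
    finally show ?thesis
      by (simp add: axis_def if_distrib[of "\<lambda>x. _ * x"] cong: if_cong)
  qed
  then show ?thesis using c that by blast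
qed

section \<open>Sign convention and identifiability\<close>

text \<open>
  The products \<open>u i * u k\<close> determine \<open>u\<close> up to a global sign, and the sign of the first nonzero entry
  determines this one.
\<close>

lemma sign_convention_unique:
  fixes u u' :: "'j::{finite,linorder} \<Rightarrow> real"
  assumes prod: "\<And>i k. u i * u k = u' i * u' k"
    and pos: "\<And>j. u j \<noteq> 0 \<Longrightarrow> \<forall>i<j. u i = 0 \<Longrightarrow> u j > 0"
    and pos': "\<And>j. u' j \<noteq> 0 \<Longrightarrow> \<forall>i<j. u' i = 0 \<Longrightarrow> u' j > 0"
  shows "u = u'"
proof (cases "\<forall>j. u j = 0")
  case True
  then have "u' j = 0" for j using prod[of j j] by simp
  then show ?thesis using True by auto
next
  case False
  define j where "j = Min {j. u j \<noteq> 0}"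
  have "j \<in> {j. u j \<noteq> 0}" unfolding j_def using False by (intro Min_in) auto
  moreover have below: "\<forall>i<j. u i = 0"
    unfolding j_def by (metis (mono_tags) Min_le finite mem_Collect_eq not_le)
  ultimately have u: "u j > 0" using pos by blast
  have "u' i = 0 \<longleftrightarrow> u i = 0" for i using prod[of i i] by auto
  then have u': "u' j > 0" using pos' u below by force
  have "(u j)\<^sup>2 = (u' j)\<^sup>2" using prod[of j j] by (simp add: power2_eq_square)
  then have "u j = u' j" using u u' by (simp add: power2_eq_iff)
  then have "u i = u' i" for i using prod[of i j] u by simp
  then show ?thesis by auto
qed

theorem theorem5:
  fixes tst :: "'j::{finite,linorder} \<Rightarrow> 'g::finite"
    and A :: "real^('l::finite + 'g)^'j::{finite,linorder}"
    and d :: "real^'j::{finite,linorder}"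
    and S :: "real^'l^'l"
    and lam :: "real^'j::{finite,linorder}"
  assumes "surj tst"
    and "(A, d, S, lam) \<in> two_tier_params tst"
    and "C0 A"
    and "T1S tst A \<or> T2S tst A \<or> T3S tst A"
  shows "identifiable_at tst A d S lam"
  unfolding identifiable_at_def
proof (intro allI impI; elim conjE)
  fix A' :: "real^('l::finite + 'g)^'j::{finite,linorder}" and d' S' lam'
  assume params': "(A', d', S', lam') \<in> two_tier_params tst"
    and law: "two_tier_law tst A' d' S' lam' = two_tier_law tst A d S lam"
    and pattern: "nonzero_pattern A' = nonzero_pattern A"
  let ?F = "factor_cov S :: real^('l + 'g)^('l + 'g)"
  let ?F' = "factor_cov S' :: real^('l + 'g)^('l + 'g)"
  have A: "\<forall>j g. g \<noteq> tst j \<longrightarrow> A $ j $ Inr g = 0" and pd: "positive_definite S"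
    and unit: "\<And>l. S $ l $ l = 1" and lam: "\<forall>j. lam $ j > 0"
    and sign: "\<And>k j. A $ j $ k \<noteq> 0 \<Longrightarrow> \<forall>i<j. A $ i $ k = 0 \<Longrightarrow> A $ j $ k > 0"
    using assms(2) by (auto simp: two_tier_params_def)
  have A': "\<forall>j g. g \<noteq> tst j \<longrightarrow> A' $ j $ Inr g = 0" and pd': "positive_definite S'"
    and unit': "\<And>l. S' $ l $ l = 1" and lam': "\<forall>j. lam' $ j > 0"
    and sign': "\<And>k j. A' $ j $ k \<noteq> 0 \<Longrightarrow> \<forall>i<j. A' $ i $ k = 0 \<Longrightarrow> A' $ j $ k > 0"
    using params' by (auto simp: two_tier_params_def)
  have zero: "A' $ j $ k = 0 \<longleftrightarrow> A $ j $ k = 0" for j k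
    using pattern by (auto simp: nonzero_pattern_def vec_eq_iff of_bool_def split: if_splits) 
  note moments = two_tier_law_moments[OF A A' pd pd' lam lam' law]

  have communality: "A $ j \<bullet> (?F *v A $ j) = A' $ j \<bullet> (?F' *v A' $ j)" for j
  proof -
    obtain R1 R2 where R: "R1 \<subseteq> UNIV - {j}" "R2 \<subseteq> UNIV - {j}" "R1 \<inter> R2 = {}"
      "full_column_rank A R1 UNIV" "full_column_rank A R2 UNIV"
      using assms(3)[unfolded C0_def, rule_format, of j] by (elim exE conjE) (rule that)
    have "span (($) A ` R1) = UNIV" "span (($) A ` R2) = UNIV"
      using R(4,5)[THEN full_column_rank_span, of id] by (simp_all add: vec_lambda_eta)
    then show ?thesis
    proof (rule communality_unique[OF pd_factor_cov(1)[OF pd] pd_factor_cov(1)[OF pd']])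
      show "R1 \<inter> R2 = {}" "j \<notin> R1" "j \<notin> R2" using R(1-3) by auto
      show "A $ i \<bullet> (?F *v A $ k) = A' $ i \<bullet> (?F' *v A' $ k)" if "i \<noteq> k" for i k
        using moments(2)[of i k] that by simp
    qed
  qed
  have "lam $ j = lam' $ j" for j
    using moments(2)[of j j] communality[of j] by simp
  then have lam_eq: "lam = lam'" by (simp add: vec_eq_iff)

  define f where "f i = (\<chi> l. A $ i $ Inl l)" for i
  define f' where "f' i = (\<chi> l. A' $ i $ Inl l)" for i
  define b where "b i = A $ i $ Inr (tst i)" for i
  define b' where "b' i = A' $ i $ Inr (tst i)" for i
  have cov: "f i \<bullet> (S *v f k) + of_bool (tst i = tst k) * (b i * b k)
      = f' i \<bullet> (S' *v f' k) + of_bool (tst i = tst k) * (b' i * b' k)" for i k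
  proof -
    have "A $ i \<bullet> (?F *v A $ k) = A' $ i \<bullet> (?F' *v A' $ k)"
      using moments(2)[of i k] lam_eq by simp
    then show ?thesis
      by (simp add: pd_factor_cov(2)[OF pd] pd_factor_cov(2)[OF pd'] testlet_covariance[OF A] testlet_covariance[OF A']
          f_def f'_def b_def b'_def)
  qed
  have spanH4: "span (f ` items tst {g}) = UNIV" if "g \<in> H4 tst A" for g
    using full_column_rank_span[of A "items tst {g}" "range Inl" Inl] that
    by (simp add: H4_def f_def[abs_def])
  have isometry: "\<exists>T. linear T \<and> (\<forall>i. f' i = T (f i)) \<and> (\<forall>x y. x \<bullet> (S *v y) = T x \<bullet> (S' *v T y))"
    if rank1: "full_column_rank A (items tst G1) (main_factors \<union> Inr ` G1)"
      and span2: "span (f ` items tst (- G1)) = UNIV" for G1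
  proof (rule isometry_from_testlet_bipartition[OF pd pd' _ span2 _ cov])
    show "span (f ` items tst G1) = UNIV"
      using full_column_rank_span[OF rank1, of Inl] by (simp add: f_def[abs_def])
    fix g assume g: "g \<in> G1"
    \<comment> \<open>The weights produce the unit vector of column \<open>Inr g\<close>, so they kill the main loadings.\<close>
    then obtain w where w: "\<And>k. k \<in> main_factors \<union> Inr ` G1 \<Longrightarrow>
        (\<Sum>i\<in>items tst G1. w i * A $ i $ k) = of_bool (k = Inr g)"
      using full_column_rank_solve[OF rank1, of "Inr g"] by blast
    have "(\<Sum>i\<in>items tst {g}. w i * b i) = (\<Sum>i\<in>items tst G1. w i * A $ i $ Inr g)"
      using g A by (intro sum.mono_neutral_cong_left) (auto simp: items_def b_def)
    moreover have "(\<Sum>i\<in>items tst G1. w i *\<^sub>R f i) = 0"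
      using w by (simp add: vec_eq_iff f_def)
    ultimately show "\<exists>w. (\<Sum>i\<in>items tst G1. w i *\<^sub>R f i) = 0 \<and> (\<Sum>i\<in>items tst {g}. w i * b i) = 1"
      using w[of "Inr g"] g by auto
  qed
  from assms(4) have "contains_identity A UNIV \<and>
    (\<exists>T. linear T \<and> (\<forall>i. f' i = T (f i)) \<and> (\<forall>x y. x \<bullet> (S *v y) = T x \<bullet> (S' *v T y)))"
  proof (elim disjE)
    assume T1: "T1S tst A"
    then obtain H where "H \<subseteq> H4 tst A" "card H = 3"
      by (metis T1S_def obtain_subset_with_card_n)
    then obtain g1 g2 g3 where g: "g1 \<in> H4 tst A" "g2 \<in> H4 tst A" "g3 \<in> H4 tst A"
      "g1 \<noteq> g2" "g1 \<noteq> g3" "g2 \<noteq> g3"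
      by (auto simp: card_3_iff)
    have "f i \<bullet> (S *v f j) = f' i \<bullet> (S' *v f' j)" if "tst i \<noteq> tst j" for i j
      using cov[of i j] that by simp
    then show ?thesis
      using isometry_from_three_testlets[OF pd pd' spanH4 spanH4 spanH4] g T1
      by (auto simp: T1S_def contains_identity_def)
  next
    assume T2: "T2S tst A"
    then obtain g1 where g1: "g1 \<in> H5 tst A"
      by (metis T2S_def card.empty not_one_le_zero ex_in_conv)
    \<comment> \<open>With \<open>G1 = {g1}\<close>, a second testlet in \<open>H4\<close> makes the complement span.\<close>
    obtain g2 where g2: "g2 \<in> H4 tst A" "g2 \<noteq> g1"
    proof -
      have "\<not> H4 tst A \<subseteq> {g1}"
        using T2 card_mono[of "{g1}" "H4 tst A"] by (auto simp: T2S_def)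
      then show ?thesis using that by blast
    qed
    have "items tst {g2} \<subseteq> items tst (- {g1})" using g2 by (auto simp: items_def)
    then have "span (f ` items tst (- {g1})) = UNIV"
      using spanH4[OF g2(1)] span_mono[OF image_mono, of "items tst {g2}" "items tst (- {g1})" f] by auto
    then show ?thesis
      using isometry[of "{g1}"] g1 T2 by (auto simp: H5_def T2S_def contains_identity_def)
  next
    assume "T3S tst A"
    then obtain G1 G2 where G: "contains_identity A UNIV" "G1 \<union> G2 = UNIV" "G1 \<inter> G2 = {}"
      "full_column_rank A (items tst G1) (main_factors \<union> Inr ` G1)"
      "full_column_rank A (items tst G2) main_factors"
      unfolding T3S_def by blast
    have "G2 = - G1" using G(2,3) by blast
    then have "span (f ` items tst (- G1)) = UNIV"
      using full_column_rank_span[OF G(5), of Inl] by (simp add: f_def[abs_def])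
    then show ?thesis using isometry[OF G(4)] G(1) by blast
  qed
  then obtain T where ident: "contains_identity A UNIV" and T: "linear T" "\<And>i. f' i = T (f i)"
    "\<And>x y. x \<bullet> (S *v y) = T x \<bullet> (S' *v T y)"
    by blast
  obtain c where c: "\<And>l. T (axis l 1) = c l *\<^sub>R axis l 1" "\<And>l. c l * c l = 1"
    "\<And>i l. f' i $ l = c l * f i $ l"
  proof (rule isometry_diagonal[OF T unit unit'])
    show "\<exists>j. f j $ l \<noteq> 0 \<and> (\<forall>l'. l' \<noteq> l \<longrightarrow> f j $ l' = 0)" for l
      using ident by (auto simp: contains_identity_def f_def)
  qed (use zero in \<open>auto simp: f_def f'_def\<close>)

  have main: "A $ i $ Inl l = A' $ i $ Inl l" for i l
  proof -
    have "(\<lambda>i. A $ i $ Inl l) = (\<lambda>i. A' $ i $ Inl l)"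
    proof (rule sign_convention_unique)
      fix i k
      have "A' $ i $ Inl l * A' $ k $ Inl l = (c l * c l) * (A $ i $ Inl l * A $ k $ Inl l)"
        using c(3)[of i l] c(3)[of k l] by (simp add: f_def f'_def mult_ac)
      then show "A $ i $ Inl l * A $ k $ Inl l = A' $ i $ Inl l * A' $ k $ Inl l"
        using c(2)[of l] by simp
    qed (fact sign sign')+
    then show ?thesis by metis
  qed
  have "f' = f" by (simp add: f_def f'_def main fun_eq_iff)
  have "T x = x" for x
  proof -
    have "c l = 1" for l
    proof -
      obtain j where "f j $ l \<noteq> 0" using ident by (auto simp: contains_identity_def f_def)
      then show ?thesis using c(3)[of j l] \<open>f' = f\<close> by simp
    qed
    note c1 = this
    have "T x = id x"
      by (rule linear_eq_on_span[OF T(1) linear_id, of Basis]) 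
        (use c(1) c1 in \<open>force simp: Basis_vec_def\<close>, simp)
    then show ?thesis by simp
  qed
  then have SS: "x \<bullet> (S *v y) = x \<bullet> (S' *v y)" for x y
    using T(3) by simp
  then have "S *v y = S' *v y" for y using vector_eq_ldot by blast
  then have S_eq: "S = S'" by (simp add: matrix_eq)
  have testlet: "A $ i $ Inr g = A' $ i $ Inr g" for i g
  proof -
    have "(\<lambda>i. A $ i $ Inr g) = (\<lambda>i. A' $ i $ Inr g)"
    proof (rule sign_convention_unique)
      fix i k
      show "A $ i $ Inr g * A $ k $ Inr g = A' $ i $ Inr g * A' $ k $ Inr g"
      proof (cases "tst i = g \<and> tst k = g")
        case True
        then show ?thesis
          using cov[of i k] SS \<open>f' = f\<close> by (simp add: b_def b'_def)
      next
        case False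
        then show ?thesis using A A' by auto
      qed
    qed (fact sign sign')+
    then show ?thesis by metis
  qed
  have "A $ i $ k = A' $ i $ k" for i k
    using main testlet by (cases k) auto
  then have "A = A'" by (simp add: vec_eq_iff)
  then show "(A', d', S', lam') = (A, d, S, lam)"
    using moments(1) S_eq lam_eq by simp
qed

end
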